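(* Let $(\Omega,\Sigma,\mu)$ be an atomless probability space, let $T:\Omega\to\Omega$ be an invertible measure-preserving transformation, and let $(a_k)_{k\in\mathbb{Z}}$ be a sequence of positive real numbers with $\sum_{k\in\mathbb{Z}}a_k=1$ and $\sum_{k\in\mathbb{Z}}\sqrt{a_k}<\infty$. Then the Banach space $X=(L_1(\mu),|||\cdot|||)$, where $$|||f|||=\int_\Omega\Big(\sum_{k\in\mathbb{Z}}a_k|f(T^k\omega)|^2\Big)^{1/2}d\mu(\omega),$$ has the Daugavet property.
   Context: $L_1(\mu)$ is over $\mathbb{K}=\mathbb{R}$ or $\mathbb{C}$. An invertible measure-preserving transformation is a bijection $T:\Omega\to\Omega$ such that $T$ and $T^{-1}$ are measurable and $\mu(T^{-1}(A))=\mu(A)$ for every $A\in\Sigma$. The functional $|||\cdot|||$ is an equivalent norm on $L_1(\mu)$, with $\|f\|_1\le|||f|||\le(\sum_{k}\sqrt{a_k})\|f\|_1$. A Banach space $X$ has the Daugavet property if $\|I+R\|=1+\|R\|$ for every rank-one bounded linear operator $R:X\to X$, where $I$ is the identity of $X$. *)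

theory Defs
  imports "HOL-Probability.Probability" "HOL-Algebra.Algebraic_Closure_Type"
begin

section \<open>Normed spaces with an explicit carrier\<close>

text \<open>The space \<open>L\<^sub>1(\<mu>)\<close> depends on a measure and so cannot be an instance of a type
  class.  Normed spaces are therefore records over \<open>HOL-Algebra\<close> modules; the scalars are a type
  \<open>'k\<close>, turned into a ring record by \<^const>\<open>ring_of_type_algebra\<close>.\<close>

record ('k, 'x) normed_module = "('k, 'x) module" +
  nrm :: "'x \<Rightarrow> real"

definition normed_space :: "('k::real_normed_field, 'x) normed_module \<Rightarrow> bool" where
  "normed_space E \<longleftrightarrow>
     Module.module (ring_of_type_algebra :: 'k ring) E \<and>
     (\<forall>x\<in>carrier E. 0 \<le> nrm E x) \<and>
     (\<forall>x\<in>carrier E. nrm E x = 0 \<longleftrightarrow> x = \<zero>\<^bsub>E\<^esub>) \<and>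
     (\<forall>c. \<forall>x\<in>carrier E. nrm E (c \<odot>\<^bsub>E\<^esub> x) = norm c * nrm E x) \<and>
     (\<forall>x\<in>carrier E. \<forall>y\<in>carrier E. nrm E (x \<oplus>\<^bsub>E\<^esub> y) \<le> nrm E x + nrm E y)"

text \<open>\<open>Metric_space.mcomplete\<close> is not used, because the locale \<open>Metric_space\<close> demands symmetry
  and nonnegativity of the distance off the carrier as well.\<close>

definition banach_space :: "('k::real_normed_field, 'x) normed_module \<Rightarrow> bool" where
  "banach_space E \<longleftrightarrow>
     normed_space E \<and>
     (\<forall>s. range s \<subseteq> carrier E \<and>
          (\<forall>\<epsilon>>0. \<exists>N::nat. \<forall>m\<ge>N. \<forall>n\<ge>N. nrm E (s m \<ominus>\<^bsub>E\<^esub> s n) < \<epsilon>) \<longrightarrow>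
        (\<exists>x\<in>carrier E. (\<lambda>n. nrm E (s n \<ominus>\<^bsub>E\<^esub> x)) \<longlonglongrightarrow> 0))"

definition linear_operator ::
    "('k::real_normed_field, 'x) normed_module \<Rightarrow> ('x \<Rightarrow> 'x) \<Rightarrow> bool" where
  "linear_operator E R \<longleftrightarrow>
     R \<in> carrier E \<rightarrow> carrier E \<and>
     (\<forall>x\<in>carrier E. \<forall>y\<in>carrier E. R (x \<oplus>\<^bsub>E\<^esub> y) = R x \<oplus>\<^bsub>E\<^esub> R y) \<and>
     (\<forall>c. \<forall>x\<in>carrier E. R (c \<odot>\<^bsub>E\<^esub> x) = c \<odot>\<^bsub>E\<^esub> R x)"

definition bounded_operator ::
    "('k::real_normed_field, 'x) normed_module \<Rightarrow> ('x \<Rightarrow> 'x) \<Rightarrow> bool" where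
  "bounded_operator E R \<longleftrightarrow>
     linear_operator E R \<and> (\<exists>C. \<forall>x\<in>carrier E. nrm E (R x) \<le> C * nrm E x)"

text \<open>The supremum is meaningful only for bounded operators (bounded nonempty set of reals).\<close>

definition operator_norm ::
    "('k::real_normed_field, 'x) normed_module \<Rightarrow> ('x \<Rightarrow> 'x) \<Rightarrow> real" where
  "operator_norm E R = (SUP x\<in>{x \<in> carrier E. nrm E x \<le> 1}. nrm E (R x))"

definition rank_one ::
    "('k::real_normed_field, 'x) normed_module \<Rightarrow> ('x \<Rightarrow> 'x) \<Rightarrow> bool" where
  "rank_one E R \<longleftrightarrow>
     (\<exists>y\<in>carrier E. y \<noteq> \<zero>\<^bsub>E\<^esub> \<and> R ` carrier E = range (\<lambda>c. c \<odot>\<^bsub>E\<^esub> y))"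

definition daugavet_property :: "('k::real_normed_field, 'x) normed_module \<Rightarrow> bool" where
  "daugavet_property E \<longleftrightarrow>
     banach_space E \<and>
     (\<forall>R. bounded_operator E R \<and> rank_one E R \<longrightarrow>
        operator_norm E (\<lambda>x. x \<oplus>\<^bsub>E\<^esub> R x) = 1 + operator_norm E R)"

section \<open>Measure-theoretic notions\<close>

definition atomless :: "'w measure \<Rightarrow> bool" where
  "atomless M \<longleftrightarrow>
     (\<forall>A\<in>sets M. 0 < emeasure M A \<longrightarrow>
        (\<exists>B\<in>sets M. B \<subseteq> A \<and> 0 < emeasure M B \<and> emeasure M B < emeasure M A))"

definition invertible_measure_preserving :: "'w measure \<Rightarrow> ('w \<Rightarrow> 'w) \<Rightarrow> bool" where
  "invertible_measure_preserving M T \<longleftrightarrow>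
     bij_betw T (space M) (space M) \<and>
     T \<in> measurable M M \<and>
     inv_into (space M) T \<in> measurable M M \<and>
     (\<forall>A\<in>sets M. emeasure M (T -` A \<inter> space M) = emeasure M A)"

definition int_iterate :: "'w measure \<Rightarrow> ('w \<Rightarrow> 'w) \<Rightarrow> int \<Rightarrow> 'w \<Rightarrow> 'w" where
  "int_iterate M T k =
     (if 0 \<le> k then T ^^ nat k else inv_into (space M) T ^^ nat (- k))"

section \<open>The space \<open>L\<^sub>1(\<mu>)\<close> with the orbit norm\<close>

text \<open>For integrable \<open>f\<close> the inner series converges almost everywhere (under the assumptions on
  \<open>a\<close> and \<open>T\<close> of the theorem), so the convention that \<^const>\<open>infsum\<close> is \<open>0\<close> on divergent series
  only concerns a null set.\<close>

definition orbit_norm ::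
    "'w measure \<Rightarrow> ('w \<Rightarrow> 'w) \<Rightarrow> (int \<Rightarrow> real) \<Rightarrow> ('w \<Rightarrow> 'k::real_normed_field) \<Rightarrow> real" where
  "orbit_norm M T a f =
     (\<integral>w. sqrt (\<Sum>\<^sub>\<infinity>k\<in>UNIV. a k * (norm (f (int_iterate M T k w)))\<^sup>2) \<partial>M)"

definition ae_class ::
    "'w measure \<Rightarrow> ('w \<Rightarrow> 'k::{real_normed_field, banach, second_countable_topology})
      \<Rightarrow> ('w \<Rightarrow> 'k) set" where
  "ae_class M f = {g. integrable M g \<and> (AE w in M. g w = f w)}"

definition ae_rep :: "('w \<Rightarrow> 'k) set \<Rightarrow> 'w \<Rightarrow> 'k" where
  "ae_rep F = (SOME f. f \<in> F)"

text \<open>The vectors are almost-everywhere classes of integrable functions; the operations and the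
  norm are computed on representatives, whose choice is immaterial (see the lemmas below for the
  operations; for the norm, it is because the countably many \<open>T\<^sup>k\<close> preserve null sets).  The fields
  \<open>mult\<close> and \<open>one\<close> are inherited from the record of rings, and modules do not use them.\<close>

definition orbit_L1 ::
    "'w measure \<Rightarrow> ('w \<Rightarrow> 'w) \<Rightarrow> (int \<Rightarrow> real) \<Rightarrow>
      ('k::{real_normed_field, banach, second_countable_topology}, ('w \<Rightarrow> 'k) set) normed_module"
  where
  "orbit_L1 M T a =
     \<lparr>carrier = ae_class M ` {f. integrable M f},
      mult = undefined,
      one = undefined,
      zero = ae_class M (\<lambda>_. 0),
      add = (\<lambda>F G. ae_class M (\<lambda>w. ae_rep F w + ae_rep G w)),
      smult = (\<lambda>c F. ae_class M (\<lambda>w. c * ae_rep F w)),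
      nrm = (\<lambda>F. orbit_norm M T a (ae_rep F))\<rparr>"

lemma ae_class_eqI: "AE w in M. f w = g w \<Longrightarrow> ae_class M f = ae_class M g"
  unfolding ae_class_def by (intro Collect_cong conj_cong refl) (auto elim: AE_mp)

lemma ae_rep_class:
  assumes "integrable M f"
  shows "integrable M (ae_rep (ae_class M f))" "AE w in M. ae_rep (ae_class M f) w = f w"
proof -
  have "ae_rep (ae_class M f) \<in> ae_class M f"
    unfolding ae_rep_def by (rule someI[of _ f]) (use assms in \<open>simp add: ae_class_def\<close>)
  then show "integrable M (ae_rep (ae_class M f))" "AE w in M. ae_rep (ae_class M f) w = f w"
    by (auto simp: ae_class_def)
qed

lemma orbit_L1_add:
  assumes "integrable M f" "integrable M g"
  shows "ae_class M f \<oplus>\<^bsub>orbit_L1 M T a\<^esub> ae_class M g = ae_class M (\<lambda>w. f w + g w)"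
  using ae_rep_class(2)[OF assms(1)] ae_rep_class(2)[OF assms(2)]
  by (auto simp: orbit_L1_def intro!: ae_class_eqI)

lemma orbit_L1_smult:
  assumes "integrable M f"
  shows "c \<odot>\<^bsub>orbit_L1 M T a\<^esub> ae_class M f = ae_class M (\<lambda>w. c * f w)"
  using ae_rep_class(2)[OF assms] by (auto simp: orbit_L1_def intro!: ae_class_eqI)

end

theory Submission
  imports Defs "HOL-Real_Asymp.Real_Asymp"
begin

text \<open>
  Write \<open>N\<close> for the orbit norm and \<open>\<Phi> f\<close> for the function \<open>\<omega> \<mapsto> (\<Sum>k. a k * \<bar>f (T\<^sup>k \<omega>)\<bar>\<^sup>2)\<^sup>1\<^sup>/\<^sup>2\<close>, so
  that \<open>N f\<close> is the integral of \<open>\<Phi> f\<close>.  For the usual norm of \<open>L\<^sub>1\<close> the Daugavet property comes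
  from cutting \<open>f\<close> into pieces with small supports: the norm is additive over disjoint supports, so
  a functional that nearly attains its norm at \<open>f\<close> nearly attains it at one of the normalised pieces,
  and a function of norm one supported on a small set almost adds up with a fixed \<open>y\<close>.  The orbit norm is not additive over disjoint
  supports, because \<open>\<Phi>\<close> mixes the values along an orbit.  It is additive over disjoint \<^emph>\<open>invariant\<close>
  sets, and almost so over sets that are almost invariant.  Such sets can be small even when \<open>T\<close> is
  ergodic.

  Small almost invariant sets are found in \<open>almost_invariant_labels\<close>.  Partition the space into small sets
  \<open>C\<^sub>0, \<dots>, C\<^sub>m\<close>.  Let \<open>i \<omega>\<close> be the least index of a set visited by the whole orbit of \<open>\<omega>\<close>, and \<open>d \<omega>\<close> the
  distance along the orbit to the nearest visit to that set.  Then \<open>i\<close> is invariant and \<open>d\<close> changes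
  by at most one under \<open>T\<close>.  Label \<open>\<omega>\<close> by \<open>i \<omega>\<close> and by the block of length \<open>J\<close> in which \<open>d \<omega> + s\<close>
  lies.  The points with a given label lie in at most \<open>2 J\<close> translates of one \<open>C\<^sub>i\<close>, and the label
  changes under \<open>T\<close> only at a block boundary, which for a suitable offset \<open>s\<close> happens with
  probability at most \<open>1 / J\<close>.

  The orbit norm is localised in \<open>orbit_splitting\<close>.  Cut \<open>f\<close> along the labels into pieces \<open>f\<^sub>p\<close> supported on \<open>A\<^sub>p\<close>.
  The function \<open>\<Phi> f\<^sub>p\<close> leaks out of \<open>A\<^sub>p\<close> only at points whose orbit changes label, and the total leakage
  is at most \<open>\<Sum>k. \<surd>(a k) * \<integral>\<bar>f \<circ> T\<^sup>k\<bar>\<close> restricted to the points whose label differs from that of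
  their \<open>k\<close>-th iterate; this is small because \<open>\<Sum>k. \<surd>(a k)\<close> converges.  Hence \<open>\<Sum>p. N f\<^sub>p\<close> exceeds \<open>N f\<close>
  only slightly.  On the other hand \<open>N f\<^sub>p + N y \<le> N (f\<^sub>p + y)\<close> up to twice the leakage of \<open>f\<^sub>p\<close> and
  twice the integral of \<open>\<Phi> y\<close> over the small set \<open>A\<^sub>p\<close> (\<open>orbit_norm_separation\<close>).

  A pigeonhole argument concludes (\<open>daugavet_lower_bound\<close>).  If \<open>R\<close> has rank one and almost attains its norm at \<open>f\<close>, then
  \<open>\<parallel>R f\<parallel> \<le> \<Sum>p. \<parallel>R f\<^sub>p\<parallel>\<close>, so some piece, with its leakage taken into account, is almost as good as \<open>f\<close>.
  The leakage of that piece is then compared with its own norm, which is what survives normalisation.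
  Since \<open>R f\<^sub>p\<close> is a multiple of one fixed \<open>y\<close>, the normalised piece \<open>u\<close> satisfies
  \<open>\<parallel>u + R u\<parallel> \<ge> 1 + \<parallel>R\<parallel> - \<epsilon>\<close>.  Completeness holds because \<open>N\<close> is equivalent to the usual norm.
\<close>

section \<open>Square summable families and termwise integration\<close>

definition l2_norm :: "('i \<Rightarrow> real) \<Rightarrow> real" where
  "l2_norm u = sqrt (\<Sum>\<^sub>\<infinity>k\<in>UNIV. (u k)\<^sup>2)"

lemma L2_set_le_infsum:
  assumes "\<And>k. 0 \<le> u k" "u summable_on UNIV" "finite F"
  shows "L2_set u F \<le> infsum u UNIV"
  using L2_set_le_sum[of F u] finite_sum_le_infsum[of u UNIV F] assms by fastforce

lemma square_summable:
  assumes "\<And>k. 0 \<le> u k" "(u :: 'i \<Rightarrow> real) summable_on UNIV"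
  shows "(\<lambda>k. (u k)\<^sup>2) summable_on UNIV"
proof (rule nonneg_bdd_above_summable_on)
  have "(\<Sum>k\<in>F. (u k)\<^sup>2) \<le> (infsum u UNIV)\<^sup>2" if "finite F" for F
    using L2_set_le_infsum[OF assms that] by (simp add: L2_set_def sqrt_le_D)
  then show "bdd_above (sum (\<lambda>k. (u k)\<^sup>2) ` {F. F \<subseteq> UNIV \<and> finite F})"
    by (auto intro!: bdd_aboveI2)
qed simp

text \<open>Through this limit the finite Minkowski inequality and the comparison of the \<open>l\<^sub>2\<close> and \<open>l\<^sub>1\<close> norms pass
  to families over an infinite index set.\<close>

lemma L2_set_tendsto_l2_norm:
  assumes "\<And>k. 0 \<le> u k" "u summable_on UNIV"
  shows "(L2_set u \<longlongrightarrow> l2_norm u) (finite_subsets_at_top UNIV)"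
  unfolding L2_set_def l2_norm_def
  by (intro tendsto_real_sqrt infsum_tendsto square_summable assms)

lemma l2_norm_nonneg: "0 \<le> l2_norm u"
  by (simp add: l2_norm_def infsum_nonneg)

lemma l2_norm_cmult: "l2_norm (\<lambda>k. c * u k) = \<bar>c\<bar> * l2_norm u"
  by (simp add: l2_norm_def power_mult_distrib infsum_cmult_right' real_sqrt_mult)

lemma l2_norm_le_infsum:
  assumes "\<And>k. 0 \<le> u k" "u summable_on UNIV"
  shows "l2_norm u \<le> infsum u UNIV"
  by (rule tendsto_upperbound[OF L2_set_tendsto_l2_norm[OF assms]])
     (auto intro!: eventually_finite_subsets_at_top_weakI L2_set_le_infsum assms)

lemma l2_norm_mono:
  assumes "\<And>k. 0 \<le> u k" "\<And>k. u k \<le> v k" "v summable_on UNIV"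
  shows "l2_norm u \<le> l2_norm v"
proof -
  have "0 \<le> v k" for k using assms(1)[of k] assms(2)[of k] by linarith
  moreover from this have "u summable_on UNIV"
    by (rule_tac summable_on_comparison_test[OF assms(3)]) (use assms in auto)
  ultimately show ?thesis
    using assms unfolding l2_norm_def
    by (intro real_sqrt_le_mono infsum_mono square_summable power_mono) auto
qed

lemma l2_norm_triangle:
  assumes "\<And>k. 0 \<le> u k" "u summable_on UNIV" "\<And>k. 0 \<le> v k" "v summable_on UNIV"
  shows "l2_norm (\<lambda>k. u k + v k) \<le> l2_norm u + l2_norm v"
proof (rule tendsto_le[OF finite_subsets_at_top_neq_bot])
  show "((\<lambda>F. L2_set u F + L2_set v F) \<longlongrightarrow> l2_norm u + l2_norm v) (finite_subsets_at_top UNIV)"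
    by (intro tendsto_add L2_set_tendsto_l2_norm assms)
  show "((\<lambda>F. L2_set (\<lambda>k. u k + v k) F) \<longlongrightarrow> l2_norm (\<lambda>k. u k + v k)) (finite_subsets_at_top UNIV)"
    by (intro L2_set_tendsto_l2_norm add_nonneg_nonneg summable_on_add assms)
qed (simp add: L2_set_triangle_ineq)

lemma l2_norm_ge_coordinate:
  assumes "\<And>k. 0 \<le> u k" "u summable_on UNIV"
  shows "u j \<le> l2_norm u"
proof -
  have "(u j)\<^sup>2 \<le> (\<Sum>\<^sub>\<infinity>k\<in>UNIV. (u k)\<^sup>2)"
    using finite_sum_le_infsum[OF square_summable[OF assms], of "{j}"] by simp
  then show ?thesis unfolding l2_norm_def by (rule real_le_rsqrt)
qed

text \<open>Both sides are \<open>0\<close> for a divergent series, because \<open>enn2real\<close> maps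
  \<open>\<infinity>\<close> to \<open>0\<close>.  This is what makes the orbit function measurable everywhere.\<close>

lemma infsum_int_eq_ennreal_suminf:
  assumes nonneg: "\<And>k::int. 0 \<le> u k"
  shows "infsum u UNIV = enn2real (\<Sum>n. ennreal (u (int_decode n)))"
proof -
  let ?v = "\<lambda>n. u (int_decode n)"
  have eq: "infsum u UNIV = infsum ?v UNIV"
    by (rule infsum_reindex_bij_betw[OF bij_int_decode, symmetric])
  have v: "0 \<le> ?v n" for n by (rule nonneg)
  show ?thesis
  proof (cases "summable ?v")
    case True
    have "(?v has_sum suminf ?v) UNIV"
      by (rule sums_nonneg_imp_has_sum[OF summable_sums[OF True] v])
    then have "infsum u UNIV = suminf ?v" unfolding eq by (rule infsumI)
    moreover have "(\<Sum>n. ennreal (?v n)) = ennreal (suminf ?v)"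
      by (rule suminf_ennreal2[OF v True])
    ultimately show ?thesis using suminf_nonneg[OF True v] by simp
  next
    case False
    have "\<not> ?v summable_on UNIV"
      using False summable_on_UNIV_nonneg_real_iff[of ?v, OF v] by blast
    then have "infsum u UNIV = 0" unfolding eq by (rule infsum_not_exists)
    moreover have "(\<Sum>n. ennreal (?v n)) = top_class.top"
      using summable_suminf_not_top[of ?v, OF v] False by blast
    ultimately show ?thesis by simp
  qed
qed

lemma borel_measurable_infsum_int:
  fixes w :: "int \<Rightarrow> 'w \<Rightarrow> real"
  assumes [measurable]: "\<And>k::int. w k \<in> borel_measurable M" and "\<And>k x. 0 \<le> w k x"
  shows "(\<lambda>x. \<Sum>\<^sub>\<infinity>k\<in>UNIV. w k x) \<in> borel_measurable M"
proof -
  have "(\<lambda>x. \<Sum>\<^sub>\<infinity>k\<in>UNIV. w k x) = (\<lambda>x. enn2real (\<Sum>n. ennreal (w (int_decode n) x)))"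
    using assms(2) by (intro ext infsum_int_eq_ennreal_suminf)
  also have "\<dots> \<in> borel_measurable M" by measurable
  finally show ?thesis .
qed

lemma AE_summable_if_summable_integral:
  fixes v :: "nat \<Rightarrow> 'w \<Rightarrow> real"
  assumes int: "\<And>n. integrable M (v n)" and nonneg: "\<And>n x. 0 \<le> v n x"
    and sum: "summable (\<lambda>n. \<integral>x. v n x \<partial>M)"
  shows "AE x in M. summable (\<lambda>n. v n x)"
proof -
  have [measurable]: "v n \<in> borel_measurable M" for n using int by auto
  have "(\<integral>\<^sup>+x. (\<Sum>n. ennreal (v n x)) \<partial>M) = (\<Sum>n. ennreal (\<integral>x. v n x \<partial>M))"
    using int nonneg by (simp add: nn_integral_suminf nn_integral_eq_integral)
  also have "\<dots> < top_class.top"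
    using sum nonneg by (subst suminf_ennreal2) auto
  finally have fin: "(\<integral>\<^sup>+x. (\<Sum>n. ennreal (v n x)) \<partial>M) < top_class.top" .
  have "AE x in M. (\<Sum>n. ennreal (v n x)) \<noteq> \<infinity>"
    by (rule nn_integral_PInf_AE) (use fin in auto)
  then show ?thesis
    by eventually_elim (rule summable_suminf_not_top, use nonneg in auto)
qed

text \<open>Termwise integration for nonnegative integrands that are summed over \<open>\<int>\<close>; it is the only form in
  which series along an orbit are integrated.\<close>

lemma integral_infsum_int:
  fixes w :: "int \<Rightarrow> 'w \<Rightarrow> real"
  assumes int: "\<And>k. integrable M (w k)" and nonneg: "\<And>k x. 0 \<le> w k x"
    and sum: "(\<lambda>k. \<integral>x. w k x \<partial>M) summable_on UNIV"
  shows AE_summable_on_int: "AE x in M. (\<lambda>k. w k x) summable_on UNIV"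
    and integrable_infsum_int: "integrable M (\<lambda>x. \<Sum>\<^sub>\<infinity>k\<in>UNIV. w k x)"
    and integral_infsum_int_eq:
      "(\<integral>x. (\<Sum>\<^sub>\<infinity>k\<in>UNIV. w k x) \<partial>M) = (\<Sum>\<^sub>\<infinity>k\<in>UNIV. \<integral>x. w k x \<partial>M)"
proof -
  let ?v = "\<lambda>n. w (int_decode n)"
  have [measurable]: "w k \<in> borel_measurable M" for k using int by auto
  have sum': "summable (\<lambda>n. \<integral>x. ?v n x \<partial>M)"
    using summable_on_reindex_bij_betw[OF bij_int_decode, of "\<lambda>k. \<integral>x. w k x \<partial>M"] sum nonneg
    by (subst summable_on_UNIV_nonneg_real_iff[symmetric]) auto
  have ae: "AE x in M. summable (\<lambda>n. ?v n x)"
    by (rule AE_summable_if_summable_integral) (use int nonneg sum' in auto)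
  have eq: "(\<Sum>\<^sub>\<infinity>k\<in>UNIV. u k) = (\<Sum>n. u (int_decode n))"
    if "summable (\<lambda>n. u (int_decode n))" "\<And>k. 0 \<le> u k" for u :: "int \<Rightarrow> real"
  proof -
    have "infsum u UNIV = infsum (\<lambda>n. u (int_decode n)) UNIV"
      using infsum_reindex_bij_betw[OF bij_int_decode, of u] by simp
    also have "\<dots> = (\<Sum>n. u (int_decode n))"
      using that by (intro infsumI sums_nonneg_imp_has_sum) auto
    finally show ?thesis .
  qed
  show "AE x in M. (\<lambda>k. w k x) summable_on UNIV"
    using ae
  proof eventually_elim
    case (elim x)
    then have "(\<lambda>n. ?v n x) summable_on UNIV"
      using nonneg by (simp add: summable_on_UNIV_nonneg_real_iff)
    then show ?case
      using summable_on_reindex_bij_betw[OF bij_int_decode, of "\<lambda>k. w k x"] by simp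
  qed
  have ae_eq: "AE x in M. (\<Sum>n. ?v n x) = (\<Sum>\<^sub>\<infinity>k\<in>UNIV. w k x)"
    using ae by eventually_elim (use nonneg in \<open>simp add: eq\<close>)
  have prem: "AE x in M. summable (\<lambda>n. norm (?v n x))" "summable (\<lambda>n. \<integral>x. norm (?v n x) \<partial>M)"
    using ae sum' nonneg by simp_all
  have i: "integrable M (\<lambda>x. \<Sum>n. ?v n x)" 
    by (rule integrable_suminf[OF _ prem]) (use int in auto)
  have [measurable]: "(\<lambda>x. \<Sum>\<^sub>\<infinity>k\<in>UNIV. w k x) \<in> borel_measurable M"
    using nonneg by (intro borel_measurable_infsum_int) auto
  show "integrable M (\<lambda>x. \<Sum>\<^sub>\<infinity>k\<in>UNIV. w k x)"
    using i by (rule integrable_cong_AE_imp) (use ae_eq in auto)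
  have "(\<integral>x. (\<Sum>\<^sub>\<infinity>k\<in>UNIV. w k x) \<partial>M) = (\<integral>x. (\<Sum>n. ?v n x) \<partial>M)"
    using ae_eq by (intro integral_cong_AE) auto
  also have "\<dots> = (\<Sum>n. \<integral>x. ?v n x \<partial>M)"
    by (rule integral_suminf[OF _ prem]) (use int in auto)
  also have "\<dots> = (\<Sum>\<^sub>\<infinity>k\<in>UNIV. \<integral>x. w k x \<partial>M)"
    by (rule eq[symmetric]) (use sum' nonneg in auto)
  finally show "(\<integral>x. (\<Sum>\<^sub>\<infinity>k\<in>UNIV. w k x) \<partial>M) = (\<Sum>\<^sub>\<infinity>k\<in>UNIV. \<integral>x. w k x \<partial>M)" .
qed

section \<open>Fine partitions of atomless spaces\<close>

text \<open>Of a subset and its complement within \<open>A\<close>, one has at most half of the measure of \<open>A\<close>; iterate.\<close>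

lemma atomless_small_subset:
  assumes "finite_measure M" "atomless M" "A \<in> sets M" "0 < measure M A" "0 < e"
  shows "\<exists>B\<in>sets M. B \<subseteq> A \<and> 0 < measure M B \<and> measure M B \<le> e"
proof -
  interpret finite_measure M by fact
  have halve: "\<exists>B\<in>sets M. B \<subseteq> A \<and> 0 < measure M B \<and> measure M B \<le> measure M A / 2"
    if A: "A \<in> sets M" "0 < measure M A" for A
  proof -
    obtain B where B: "B \<in> sets M" "B \<subseteq> A" "0 < measure M B" "measure M B < measure M A"
      using assms(2) A unfolding atomless_def by (auto simp: emeasure_eq_measure ennreal_less_iff)
    then have "measure M (A - B) = measure M A - measure M B"
      using A by (simp add: finite_measure_Diff)
    then show ?thesis
      using A B by (intro bexI[of _ "if measure M B \<le> measure M A / 2 then B else A - B"]) auto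
  qed
  have "\<exists>B\<in>sets M. B \<subseteq> A \<and> 0 < measure M B \<and> measure M B \<le> measure M A / 2 ^ n" for n
  proof (induction n)
    case 0
    then show ?case using assms by auto
  next
    case (Suc n)
    then obtain B where B: "B \<in> sets M" "B \<subseteq> A" "0 < measure M B" "measure M B \<le> measure M A / 2 ^ n"
      by auto
    with halve[of B] obtain B' where "B' \<in> sets M" "B' \<subseteq> B" "0 < measure M B'" "measure M B' \<le> measure M B / 2"
      by auto
    with B show ?case by (intro bexI[of _ B']) auto
  qed
  moreover obtain n where "measure M A / 2 ^ n \<le> e"
  proof -
    have "(\<lambda>n. measure M A / 2 ^ n) \<longlonglongrightarrow> 0" by real_asymp
    then have "\<forall>\<^sub>F n in sequentially. measure M A / 2 ^ n < e" using \<open>0 < e\<close> by (rule order_tendstoD(2))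
    then show ?thesis using that by (meson eventually_sequentially less_imp_le order_refl)
  qed
  ultimately show ?thesis by (meson order_trans)
qed

text \<open>Let \<open>s\<close> be the supremum of the measures of finite unions of small sets.  A countable union
  attains \<open>s\<close>; if it missed a set of positive measure, a small subset of that set could be added to a
  finite union whose measure is almost \<open>s\<close>.  So \<open>s\<close> is the total measure, and some finite union leaves only
  a small set uncovered.\<close>

lemma atomless_finite_cover:
  assumes "finite_measure M" "atomless M" "0 < e"
  shows "\<exists>F. finite F \<and> F \<subseteq> {A\<in>sets M. measure M A \<le> e} \<and> \<Union>F = space M"
proof -
  interpret finite_measure M by fact
  define U where "U = {\<Union>F | F. finite F \<and> F \<subseteq> {A\<in>sets M. measure M A \<le> e}}"
  have U_sets: "A \<in> sets M" if "A \<in> U" for A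
    using that unfolding U_def by (auto intro!: sets.finite_Union)
  have U_Un: "A \<union> B \<in> U" if "A \<in> U" "B \<in> U" for A B
  proof -
    from that obtain F G where "A = \<Union>F" "B = \<Union>G" "finite (F \<union> G)" "F \<union> G \<subseteq> {A\<in>sets M. measure M A \<le> e}"
      unfolding U_def by auto
    then have "A \<union> B = \<Union>(F \<union> G)" by auto
    with \<open>finite (F \<union> G)\<close> \<open>F \<union> G \<subseteq> _\<close> show ?thesis unfolding U_def by blast
  qed
  have U_small: "A \<in> U" if "A \<in> sets M" "measure M A \<le> e" for A
    unfolding U_def using that by (intro CollectI exI[of _ "{A}"]) auto
  have "{} \<in> U" using \<open>0 < e\<close> by (intro U_small) auto
  define s where "s = (SUP A\<in>U. measure M A)"
  have bdd: "bdd_above (measure M ` U)"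
    by (rule bdd_aboveI2[of _ _ "measure M (space M)"]) (simp add: bounded_measure)
  have le_s: "measure M A \<le> s" if "A \<in> U" for A
    unfolding s_def using that bdd by (rule cSUP_upper)
  have "\<exists>A\<in>U. s - 1 / Suc n < measure M A" for n
    using less_cSUP_iff[of U "measure M" "s - 1 / Suc n"] \<open>{} \<in> U\<close> bdd by (auto simp: s_def)
  then obtain A where A: "\<And>n. A n \<in> U" "\<And>n. s - 1 / Suc n < measure M (A n)" by metis
  define A' where "A' = (\<Union>n. A n)"
  have A'[measurable]: "A' \<in> sets M" and [measurable]: "\<And>n. A n \<in> sets M"
    unfolding A'_def using A(1) U_sets by auto
  have null: "measure M (space M - A') = 0"
  proof (rule ccontr)
    assume "measure M (space M - A') \<noteq> 0"
    then have "0 < measure M (space M - A')" by (simp add: zero_less_measure_iff)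
    from atomless_small_subset[OF assms(1,2) _ this assms(3)]
    obtain B where B: "B \<in> sets M" "B \<subseteq> space M - A'" "0 < measure M B" "measure M B \<le> e" by auto
    obtain n where "1 / Suc n < measure M B" using nat_approx_posE[OF B(3)] .
    have "s - 1 / Suc n + measure M B < measure M (A n) + measure M B" using A by simp
    also have "\<dots> = measure M (A n \<union> B)"
      using B by (intro finite_measure_Union[symmetric]) (auto simp: A'_def)
    also have "\<dots> \<le> s" using A B by (intro le_s U_Un[OF A(1) U_small]) auto
    finally show False using \<open>1 / Suc n < measure M B\<close> by simp
  qed
  have "s = measure M (space M)"
  proof (rule antisym)
    show "s \<le> measure M (space M)"
      unfolding s_def using \<open>{} \<in> U\<close> by (intro cSUP_least) (auto simp: bounded_measure)
    have "(\<lambda>n. measure M (\<Union>i<n. A i)) \<longlonglongrightarrow> measure M (\<Union>n. \<Union>i<n. A i)"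
      by (rule finite_Lim_measure_incseq) (auto simp: incseq_def intro: order_less_le_trans)
    moreover have "(\<Union>n. \<Union>i<n. A i) = A'" unfolding A'_def by auto
    moreover have "(\<Union>i<n. A i) \<in> U" for n
      by (induction n) (use \<open>{} \<in> U\<close> A(1) U_Un in \<open>auto simp: lessThan_Suc\<close>)
    ultimately have "measure M A' \<le> s"
      by (auto intro: LIMSEQ_le_const2 le_s)
    then show "measure M (space M) \<le> s"
      using null by (simp add: finite_measure_compl)
  qed
  obtain A where A: "A \<in> U" "s - e < measure M A"
    using less_cSUP_iff[of U "measure M" "s - e"] \<open>{} \<in> U\<close> bdd \<open>0 < e\<close> by (auto simp: s_def)
  have "space M - A \<in> U"
    using A \<open>s = measure M (space M)\<close> U_sets by (intro U_small) (auto simp: finite_measure_compl)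
  with A have "A \<union> (space M - A) \<in> U" by (intro U_Un)
  moreover have "A \<union> (space M - A) = space M" using A U_sets sets.sets_into_space by blast
  ultimately show ?thesis unfolding U_def by auto
qed

lemma atomless_fine_partition:
  assumes "finite_measure M" "atomless M" "0 < e"
  shows "\<exists>c m. c \<in> measurable M (count_space UNIV) \<and> (\<forall>x\<in>space M. c x < (m::nat)) \<and>
    (\<forall>n. measure M {x\<in>space M. c x = n} \<le> e)"
proof -
  interpret finite_measure M by fact
  obtain F where F: "finite F" "F \<subseteq> {A\<in>sets M. measure M A \<le> e}" "\<Union>F = space M"
    using atomless_finite_cover[OF assms] by auto
  obtain A and m :: nat where A: "F = A ` {i. i < m}"
    using F(1) finite_imp_nat_seg_image_inj_on[of F] by blast
  define P where "P i x \<longleftrightarrow> i < m \<and> x \<in> A i" for i x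
  have Am: "A i \<in> sets M" "measure M (A i) \<le> e" if "i < m" for i
    using F(2) that by (auto simp: A)
  have [measurable]: "Measurable.pred M (P i)" for i
  proof (cases "i < m")
    case True
    with Am[OF this] have "Measurable.pred M (\<lambda>x. x \<in> A i)" by simp
    with True show ?thesis by (simp add: P_def[abs_def])
  qed (simp add: P_def[abs_def])
  have ex: "\<exists>i. P i x" if "x \<in> space M" for x
    using that F(3) by (auto simp: A P_def)
  have P: "P (LEAST i. P i x) x" if "x \<in> space M" for x
    using ex[OF that] by (rule LeastI_ex)
  show ?thesis
  proof (intro exI conjI)
    show "(\<lambda>x. LEAST i. P i x) \<in> measurable M (count_space UNIV)" by measurable
    show "\<forall>x\<in>space M. (LEAST i. P i x) < m" using P by (auto simp: P_def)
    show "\<forall>n. measure M {x\<in>space M. (LEAST i. P i x) = n} \<le> e"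
    proof
      fix n
      have "{x\<in>space M. (LEAST i. P i x) = n} \<subseteq> (if n < m then A n else {})"
        using P by (auto simp: P_def)
      then have "measure M {x\<in>space M. (LEAST i. P i x) = n} \<le> measure M (if n < m then A n else {})"
        using Am by (intro finite_measure_mono) auto
      also have "\<dots> \<le> e" using Am \<open>0 < e\<close> by auto
      finally show "measure M {x\<in>space M. (LEAST i. P i x) = n} \<le> e" .
    qed
  qed
qed

section \<open>Iterates of a measure-preserving bijection\<close>

locale measure_automorphism = prob_space M for M :: "'w measure" +
  fixes T :: "'w \<Rightarrow> 'w"
  assumes automorphism: "invertible_measure_preserving M T"
begin

abbreviation iter :: "int \<Rightarrow> 'w \<Rightarrow> 'w" where
  "iter \<equiv> int_iterate M T"

lemma iter_0: "iter 0 x = x" and iter_1: "iter 1 x = T x"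
  by (simp_all add: int_iterate_def)

lemma T_bij: "bij_betw T (space M) (space M)"
  and T_measurable[measurable]: "T \<in> measurable M M"
  and T_inv_measurable[measurable]: "inv_into (space M) T \<in> measurable M M"
  and T_preserving: "A \<in> sets M \<Longrightarrow> emeasure M (T -` A \<inter> space M) = emeasure M A"
  using automorphism by (auto simp: invertible_measure_preserving_def)

lemma T_space: "x \<in> space M \<Longrightarrow> T x \<in> space M"
  using T_measurable by (rule measurable_space)

lemma inv_T: "x \<in> space M \<Longrightarrow> inv_into (space M) T (T x) = x"
  using T_bij by (simp add: bij_betw_def)

lemma iter_T: 
  assumes "x \<in> space M"
  shows "iter k (T x) = iter (k + 1) x"
proof (cases "0 \<le> k")
  case True
  then have "nat (k + 1) = Suc (nat k)" by simp
  with True show ?thesis by (simp add: int_iterate_def funpow_swap1)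
next
  case False
  define n where "n = nat (- (k + 1))"
  have n: "nat (- k) = Suc n" using False by (simp add: n_def)
  have "iter k (T x) = (inv_into (space M) T ^^ n) x"
    using False n assms by (simp add: int_iterate_def funpow_Suc_right inv_T del: funpow.simps(2))
  also have "\<dots> = iter (k + 1) x"
    using False by (cases "k = - 1") (auto simp: int_iterate_def n_def)
  finally show ?thesis .
qed

lemma distr_funpow:
  assumes [measurable]: "S \<in> measurable M M" and "distr M M S = M"
  shows "distr M M (S ^^ n) = M"
proof (induction n)
  case 0
  then show ?case by (simp add: distr_id)
next
  case (Suc n)
  have [measurable]: "S ^^ n \<in> measurable M M" by (rule measurable_compose_n) simp
  have "distr M M (S ^^ Suc n) = distr (distr M M (S ^^ n)) M S"
    by (simp add: distr_distr)
  also have "\<dots> = M" using Suc assms by simp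
  finally show ?case .
qed

lemma iter_measurable[measurable]: "iter k \<in> measurable M M"
  unfolding int_iterate_def by (auto intro!: measurable_compose_n)

lemma distr_iter: "distr M M (iter k) = M"
proof -
  have T: "distr M M T = M"
    by (rule measure_eqI) (auto simp: emeasure_distr T_preserving)
  have "distr M M (inv_into (space M) T) = M"
  proof (rule measure_eqI)
    fix A assume "A \<in> sets (distr M M (inv_into (space M) T))"
    then have A: "A \<in> sets M" by simp
    then have "emeasure (distr M M (inv_into (space M) T)) A
        = emeasure M (inv_into (space M) T -` A \<inter> space M)"
      by (simp add: emeasure_distr)
    also have "\<dots> = emeasure M (T -` (inv_into (space M) T -` A \<inter> space M) \<inter> space M)"
      using A by (intro T_preserving[symmetric]) measurable
    also have "T -` (inv_into (space M) T -` A \<inter> space M) \<inter> space M = A"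
      using sets.sets_into_space[OF A] by (auto simp: inv_T T_space)
    finally show "emeasure (distr M M (inv_into (space M) T)) A = emeasure M A" .
  qed simp
  with T show ?thesis by (simp add: int_iterate_def distr_funpow)
qed

lemma iter_space: "x \<in> space M \<Longrightarrow> iter k x \<in> space M"
  using iter_measurable by (rule measurable_space)

lemma measure_iter:
  assumes [measurable]: "Measurable.pred M P"
  shows "measure M {x\<in>space M. P (iter k x)} = measure M {x\<in>space M. P x}"
proof -
  have "measure M {x\<in>space M. P x} = measure (distr M M (iter k)) {x\<in>space M. P x}"
    by (simp add: distr_iter)
  also have "\<dots> = measure M (iter k -` {x\<in>space M. P x} \<inter> space M)"
    by (rule measure_distr) auto
  also have "iter k -` {x\<in>space M. P x} \<inter> space M = {x\<in>space M. P (iter k x)}"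
    by (auto simp: iter_space)
  finally show ?thesis by simp
qed

lemma integrable_iter:
  fixes f :: "'w \<Rightarrow> 'k::{banach, second_countable_topology}"
  assumes "integrable M f"
  shows "integrable M (\<lambda>x. f (iter k x))"
  using assms integrable_distr[of "iter k" M M f] by (simp add: distr_iter)

lemma integral_iter:
  fixes f :: "'w \<Rightarrow> 'k::{banach, second_countable_topology}"
  assumes [measurable]: "f \<in> borel_measurable M"
  shows "(\<integral>x. f (iter k x) \<partial>M) = (\<integral>x. f x \<partial>M)"
  using integral_distr[of "iter k" M M f] by (simp add: distr_iter)

lemma AE_iter:
  assumes "AE x in M. P x"
  shows "AE x in M. \<forall>k. P (iter k x)"
  unfolding AE_all_countable
proof
  fix k
  show "AE x in M. P (iter k x)"
    by (rule AE_distrD[OF iter_measurable]) (unfold distr_iter, rule assms)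
qed

text \<open>A label that differs at the two ends of an orbit segment changes at one of its \<open>\<bar>k\<bar>\<close> steps, and
  each step has the same distribution as the first one.\<close>

lemma measure_label_change_le:
  fixes g :: "'w \<Rightarrow> 'l::countable"
  assumes [measurable]: "g \<in> measurable M (count_space UNIV)"
  shows "measure M {x\<in>space M. g (iter k x) \<noteq> g x}
    \<le> \<bar>real_of_int k\<bar> * measure M {x\<in>space M. g (T x) \<noteq> g x}"
proof -
  let ?B = "\<lambda>k. {x\<in>space M. g (iter k x) \<noteq> g x}"
  let ?b = "measure M {x\<in>space M. g (T x) \<noteq> g x}"
  have sets: "{x\<in>space M. g (iter k (T x)) \<noteq> g (T x)} \<in> sets M" "?B k \<in> sets M"
      "{x\<in>space M. g (T x) \<noteq> g x} \<in> sets M" for k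
    by measurable
  have shift: "measure M {x\<in>space M. g (iter k (T x)) \<noteq> g (T x)} = measure M (?B k)" for k
    using measure_iter[of "\<lambda>x. g (iter k x) \<noteq> g x" 1] by (simp add: iter_1)
  have up: "measure M (?B (k + 1)) \<le> measure M (?B k) + ?b" for k
  proof -
    have "measure M (?B (k + 1))
        \<le> measure M ({x\<in>space M. g (iter k (T x)) \<noteq> g (T x)} \<union> {x\<in>space M. g (T x) \<noteq> g x})"
      by (rule finite_measure_mono) (auto simp: iter_T sets)
    also have "\<dots> \<le> measure M {x\<in>space M. g (iter k (T x)) \<noteq> g (T x)} + ?b"
      by (intro measure_Un_le sets)
    finally show ?thesis by (simp add: shift)
  qed
  have down: "measure M (?B k) \<le> measure M (?B (k + 1)) + ?b" for k
  proof -
    have "measure M {x\<in>space M. g (iter k (T x)) \<noteq> g (T x)}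
        \<le> measure M (?B (k + 1) \<union> {x\<in>space M. g (T x) \<noteq> g x})"
      by (rule finite_measure_mono) (auto simp: iter_T sets)
    also have "\<dots> \<le> measure M (?B (k + 1)) + ?b"
      by (intro measure_Un_le sets)
    finally show ?thesis by (simp add: shift)
  qed
  show ?thesis
  proof (induction k rule: int_induct[of _ 0])
    case base
    then show ?case by (simp add: iter_0)
  next
    case (step1 i)
    then show ?case using up[of i] by (simp add: algebra_simps)
  next
    case (step2 i)
    then show ?case using down[of "i - 1"] by (simp add: algebra_simps)
  qed
qed

end

section \<open>Almost invariant partitions into small sets\<close>

text \<open>A step of size at most one crosses a boundary between blocks of length \<open>J\<close> for at most one of the
  \<open>J\<close> possible offsets of the blocks.\<close>

lemma div_step_unique:
  fixes a b s t J :: nat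
  assumes "a \<le> b + 1" "b \<le> a + 1" "s < J" "t < J"
    and "(a + s) div J \<noteq> (b + s) div J" "(a + t) div J \<noteq> (b + t) div J"
  shows "s = t"
proof -
  define n where "n = max a b"
  have step: "J dvd n + r" if "(a + r) div J \<noteq> (b + r) div J" for r
  proof -
    define l where "l = min a b"
    have n: "n = Suc l"
      using that assms(1,2) by (cases "a = b") (auto simp: n_def l_def)
    have "Suc (l + r) div J \<noteq> (l + r) div J"
      using that n by (cases "a \<le> b") (auto simp: n_def l_def max_def min_def)
    then have "Suc (l + r) mod J = 0" by (auto simp: div_Suc split: if_splits)
    then show ?thesis using n by auto
  qed
  have aux: "s = t" if "s \<le> t" "t < J" "J dvd n + s" "J dvd n + t" for s t
  proof -
    have "J dvd (n + t) - (n + s)" using that by (intro dvd_diff_nat) auto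
    then show ?thesis using that nat_dvd_not_less[of "t - s" J] by (cases "t - s = 0") auto
  qed
  show ?thesis
    using aux[of s t] aux[of t s] step assms by (cases "s \<le> t") auto
qed

lemma card_blocks_le:
  fixes J q s :: nat
  assumes "0 < J"
  shows "finite {k::int. (nat \<bar>k\<bar> + s) div J = q}" "card {k::int. (nat \<bar>k\<bar> + s) div J = q} \<le> 2 * J"
proof -
  define I where "I = {n. (n + s) div J = q}"
  have "(\<lambda>n. n + s) ` I \<subseteq> {q * J..<q * J + J}"
    using dividend_less_times_div[OF assms] by (fastforce simp: I_def mult.commute add.commute)
  then have I: "finite I" "card I \<le> J"
    using finite_imageD[OF finite_subset[of "(\<lambda>n. n + s) ` I"]] card_inj_on_le[of "\<lambda>n. n + s" I "{q * J..<q * J + J}"]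
    by (auto simp: inj_on_def)
  have sub: "{k::int. (nat \<bar>k\<bar> + s) div J = q} \<subseteq> int ` I \<union> (\<lambda>n. - int n) ` I"
  proof
    fix k :: int assume "k \<in> {k. (nat \<bar>k\<bar> + s) div J = q}"
    then have "nat \<bar>k\<bar> \<in> I" by (simp add: I_def)
    moreover have "k = int (nat \<bar>k\<bar>) \<or> k = - int (nat \<bar>k\<bar>)" by auto
    ultimately show "k \<in> int ` I \<union> (\<lambda>n. - int n) ` I" by blast
  qed
  then show "finite {k::int. (nat \<bar>k\<bar> + s) div J = q}"
    using I by (auto intro: finite_subset)
  have "card {k::int. (nat \<bar>k\<bar> + s) div J = q} \<le> card (int ` I \<union> (\<lambda>n. - int n) ` I)"
    using I sub by (intro card_mono) auto
  also have "\<dots> \<le> card (int ` I) + card ((\<lambda>n. - int n) ` I)" by (rule card_Un_le)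
  also have "\<dots> \<le> J + J" using I by (intro add_mono) (auto intro: order_trans[OF card_image_le])
  finally show "card {k::int. (nat \<bar>k\<bar> + s) div J = q} \<le> 2 * J" by simp
qed

lemma pred_eq_countable:
  fixes f g :: "'w \<Rightarrow> 'l::countable"
  assumes [measurable]: "f \<in> measurable M (count_space UNIV)" "g \<in> measurable M (count_space UNIV)"
  shows "Measurable.pred M (\<lambda>x. f x = g x)"
proof -
  have "Measurable.pred M (\<lambda>x. \<exists>n. g x = n \<and> f x = n)" by measurable
  then show ?thesis by simp
qed

context measure_automorphism
begin

text \<open>This lemma plays the role of a Rokhlin lemma, and treats periodic and aperiodic behaviour alike: along a
  short cycle the distance \<open>d\<close> is bounded and the invariant index \<open>i\<close> does the splitting, along a long
  orbit the blocks of \<open>d\<close> do.\<close>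

lemma almost_invariant_labels:
  assumes "atomless M" "0 < e"
  shows "\<exists>(g :: 'w \<Rightarrow> nat \<times> nat) P. g \<in> measurable M (count_space UNIV) \<and>
    finite P \<and> (\<forall>x\<in>space M. g x \<in> P) \<and> (\<forall>p. measure M {x\<in>space M. g x = p} \<le> e) \<and>
    measure M {x\<in>space M. g (T x) \<noteq> g x} \<le> e"
proof -
  obtain J :: nat where J: "0 < J" "1 / real J \<le> e"
    using nat_approx_posE[OF \<open>0 < e\<close>] by (metis Suc_le_eq of_nat_Suc less_imp_le zero_less_Suc)
  obtain c and m :: nat where [measurable]: "c \<in> measurable M (count_space UNIV)"
    and cm: "\<And>x. x \<in> space M \<Longrightarrow> c x < m"
    and c_small: "\<And>n. measure M {x\<in>space M. c x = n} \<le> e / (4 * real J)"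
    using atomless_fine_partition[OF finite_measure_axioms assms(1), of "e / (4 * real J)"] \<open>0 < e\<close> J
    by auto
  define i where "i x = (LEAST n. \<exists>k. c (iter k x) = n)" for x
  have [measurable]: "i \<in> measurable M (count_space UNIV)"
    unfolding i_def[abs_def] by measurable
  have i_ex: "\<exists>k. c (iter k x) = i x" for x
    unfolding i_def by (rule LeastI_ex) auto
  have i_less: "i x < m" if "x \<in> space M" for x
  proof -
    obtain k where "c (iter k x) = i x" using i_ex[of x] by blast
    then show ?thesis using cm[OF iter_space[OF that, of k]] by simp
  qed
  have i_T: "i (T x) = i x" if "x \<in> space M" for x
  proof -
    have "(\<exists>k. c (iter k (T x)) = n) \<longleftrightarrow> (\<exists>k. c (iter k x) = n)" for n
      by (metis (no_types) iter_T[OF that] diff_add_cancel)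
    then show ?thesis by (simp add: i_def)
  qed
  define d where "d x = (LEAST n. \<exists>k. nat \<bar>k\<bar> = n \<and> c (iter k x) = i x)" for x
  have [measurable]: "d \<in> measurable M (count_space UNIV)"
  proof -
    have [measurable]: "Measurable.pred M (\<lambda>x. c (iter k x) = i x)" for k
      by (rule pred_eq_countable) measurable
    have [measurable]: "Measurable.pred M (\<lambda>x. nat \<bar>k\<bar> = n \<and> c (iter k x) = i x)" for k n
      by (cases "nat \<bar>k\<bar> = n") simp_all
    have "Measurable.pred M (\<lambda>x. \<exists>k. nat \<bar>k\<bar> = n \<and> c (iter k x) = i x)" for n
      by (rule pred_intros_countable) measurable
    then show ?thesis unfolding d_def[abs_def] by (rule measurable_Least)
  qed
  have d_ex: "\<exists>k. nat \<bar>k\<bar> = d x \<and> c (iter k x) = i x" for x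
    unfolding d_def by (rule LeastI_ex) (use i_ex[of x] in auto)
  have d_le: "d x \<le> nat \<bar>k\<bar>" if "c (iter k x) = i x" for x k
    unfolding d_def by (rule Least_le) (use that in auto)
  have d_T: "d (T x) \<le> d x + 1" "d x \<le> d (T x) + 1" if "x \<in> space M" for x
  proof -
    obtain k where k: "nat \<bar>k\<bar> = d x" "c (iter k x) = i x" using d_ex[of x] by blast
    have "d (T x) \<le> nat \<bar>k - 1\<bar>" using that k(2) by (intro d_le) (simp add: iter_T i_T)
    with k(1) show "d (T x) \<le> d x + 1" by linarith
    obtain k where k: "nat \<bar>k\<bar> = d (T x)" "c (iter k (T x)) = i (T x)" using d_ex[of "T x"] by blast
    have "d x \<le> nat \<bar>k + 1\<bar>" using that k(2) by (intro d_le) (simp add: iter_T i_T)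
    with k(1) show "d x \<le> d (T x) + 1" by linarith
  qed
  obtain D where D: "measure M {x\<in>space M. D \<le> d x} \<le> e / 2"
  proof -
    have "(\<lambda>n. measure M {x\<in>space M. n \<le> d x}) \<longlonglongrightarrow> measure M (\<Inter>n. {x\<in>space M. n \<le> d x})"
      by (rule finite_Lim_measure_decseq) (auto simp: decseq_def)
    moreover have "(\<Inter>n. {x\<in>space M. n \<le> d x}) = {}"
      using not_less_eq_eq by fastforce
    ultimately have "(\<lambda>n. measure M {x\<in>space M. n \<le> d x}) \<longlonglongrightarrow> 0" by simp
    then have "\<forall>\<^sub>F n in sequentially. measure M {x\<in>space M. n \<le> d x} < e / 2"
      by (rule order_tendstoD(2)) (use \<open>0 < e\<close> in auto)
    then show ?thesis using that by (meson eventually_sequentially less_imp_le order_refl)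
  qed
  \<comment> \<open>Truncating the distance keeps it 1-Lipschitz and leaves only finitely many labels.\<close>
  define h where "h x = min (d x) D" for x
  have [measurable]: "h \<in> measurable M (count_space UNIV)"
    unfolding h_def[abs_def] by measurable
  have h_T: "h (T x) \<le> h x + 1" "h x \<le> h (T x) + 1" if "x \<in> space M" for x
    using d_T[OF that] by (auto simp: h_def)
  define B where "B s = {x\<in>space M. (h (T x) + s) div J \<noteq> (h x + s) div J}" for s
  have B_sets: "B s \<in> sets M" for s
  proof -
    have "Measurable.pred M (\<lambda>x. (h (T x) + s) div J = (h x + s) div J)"
      by (rule pred_eq_countable) measurable
    then show ?thesis unfolding B_def by measurable
  qed
  \<comment> \<open>The sets of points that cross a block boundary are disjoint for different offsets.\<close>
  have "\<exists>s<J. measure M (B s) \<le> 1 / real J"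
  proof (rule ccontr)
    assume "\<not> ?thesis"
    then have "(\<Sum>s<J. 1 / real J) < (\<Sum>s<J. measure M (B s))"
      using J by (intro sum_strict_mono) (auto simp: not_le lessThan_empty_iff)
    also have "\<dots> = measure M (\<Union>s<J. B s)"
    proof (rule finite_measure_finite_Union[symmetric])
      show "disjoint_family_on B {..<J}"
        unfolding disjoint_family_on_def B_def using div_step_unique h_T by blast
    qed (use B_sets in auto)
    also have "\<dots> \<le> 1" by (rule prob_le_1)
    finally show False using J by simp
  qed
  then obtain s where s: "s < J" "measure M (B s) \<le> 1 / real J" by blast
  define g where "g x = (i x, (h x + s) div J)" for x
  have [measurable]: "g \<in> measurable M (count_space UNIV)"
  proof -
    have "g \<in> measurable M (count_space UNIV \<Otimes>\<^sub>M count_space UNIV)"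
      unfolding g_def[abs_def] by measurable
    then show ?thesis by (simp add: pair_measure_countable)
  qed
  have "measure M {x\<in>space M. g x = p} \<le> e" for p
  proof -
    obtain n q where p: "p = (n, q)" by (cases p)
    let ?K = "{k::int. (nat \<bar>k\<bar> + s) div J = q}"
    let ?C = "\<lambda>k. {x\<in>space M. c (iter k x) = n}"
    have C: "measure M (?C k) \<le> e / (4 * real J)" for k
      using measure_iter[of "\<lambda>x. c x = n" k] c_small by simp
    have "{x\<in>space M. g x = p} \<subseteq> (\<Union>k\<in>?K. ?C k) \<union> {x\<in>space M. D \<le> d x}"
    proof
      fix x assume x: "x \<in> {x\<in>space M. g x = p}"
      obtain k where k: "nat \<bar>k\<bar> = d x" "c (iter k x) = i x" using d_ex[of x] by blast
      show "x \<in> (\<Union>k\<in>?K. ?C k) \<union> {x\<in>space M. D \<le> d x}"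
        using x k by (cases "D \<le> d x") (auto simp: g_def p h_def intro!: exI[of _ k])
    qed
    then have "measure M {x\<in>space M. g x = p} \<le> measure M ((\<Union>k\<in>?K. ?C k) \<union> {x\<in>space M. D \<le> d x})"
      by (rule finite_measure_mono) measurable
    also have "\<dots> \<le> measure M (\<Union>k\<in>?K. ?C k) + measure M {x\<in>space M. D \<le> d x}"
      by (rule measure_Un_le) measurable
    also have "measure M (\<Union>k\<in>?K. ?C k) \<le> (\<Sum>k\<in>?K. measure M (?C k))"
      using card_blocks_le[OF J(1)] by (intro measure_UNION_le) auto
    also have "\<dots> \<le> (\<Sum>k\<in>?K. e / (4 * real J))" by (intro sum_mono C)
    also have "\<dots> = real (card ?K) * (e / (4 * real J))" by simp
    also have "\<dots> \<le> real (2 * J) * (e / (4 * real J))"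
      using card_blocks_le(2)[OF J(1), of s q] J \<open>0 < e\<close> by (intro mult_right_mono) (auto simp flip: of_nat_mult)
    also have "\<dots> = e / 2" using J by simp
    finally show ?thesis using D by simp
  qed
  moreover have "{x\<in>space M. g (T x) \<noteq> g x} = B s"
    by (auto simp: g_def B_def i_T)
  then have "measure M {x\<in>space M. g (T x) \<noteq> g x} \<le> e" using s J by simp
  moreover have "g x \<in> {..<m} \<times> {..D + J}" if "x \<in> space M" for x
  proof -
    have "(h x + s) div J \<le> h x + s" by (rule div_le_dividend)
    also have "\<dots> \<le> D + J" using s by (simp add: h_def add_mono)
    finally show ?thesis using i_less[OF that] by (simp add: g_def)
  qed
  ultimately show ?thesis
    by (intro exI[of _ g] exI[of _ "{..<m} \<times> {..D + J}"]) auto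
qed

end

section \<open>The orbit norm on integrable functions\<close>

text \<open>Uniform integrability in quantitative form: above a high level \<open>C\<close> an integrable function has little
  mass, so that its integral over a set \<open>B\<close> is at most \<open>e\<close> plus \<open>C\<close> times the measure of \<open>B\<close>.  The level
  depends only on the distribution of the function, hence is the same for all its translates under \<open>T\<close>.\<close>

lemma integrable_truncation:
  fixes f :: "'w \<Rightarrow> real"
  assumes f: "integrable M f" "\<And>x. 0 \<le> f x" and "0 < e"
  shows "\<exists>C>0. (\<integral>x. f x - min (f x) C \<partial>M) \<le> e"
proof -
  have [measurable]: "f \<in> borel_measurable M" using f by auto
  have "(\<lambda>n. \<integral>x. f x - min (f x) (real n) \<partial>M) \<longlonglongrightarrow> (\<integral>x. 0 \<partial>M)"
  proof (rule integral_dominated_convergence[where w = f])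
    show "AE x in M. (\<lambda>n. f x - min (f x) (real n)) \<longlonglongrightarrow> 0"
    proof
      fix x
      obtain N where "f x \<le> real N" using real_arch_simple by blast
      then have "\<forall>\<^sub>F n in sequentially. f x - min (f x) (real n) = 0"
        by (auto simp: eventually_sequentially intro!: exI[of _ N])
      then show "(\<lambda>n. f x - min (f x) (real n)) \<longlonglongrightarrow> 0" by (rule tendsto_eventually)
    qed
  qed (use f in auto)
  then have "\<forall>\<^sub>F n in sequentially. (\<integral>x. f x - min (f x) (real n) \<partial>M) < e"
    by (intro order_tendstoD(2)) (use \<open>0 < e\<close> in auto)
  then have "\<forall>\<^sub>F n in sequentially. (\<integral>x. f x - min (f x) (real n) \<partial>M) < e \<and> 0 < n"
    using eventually_gt_at_top[of 0] by eventually_elim auto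
  then obtain n where "(\<integral>x. f x - min (f x) (real n) \<partial>M) < e" "0 < n"
    by (auto dest: eventually_happens)
  then show ?thesis by (intro exI[of _ "real n"]) auto
qed

lemma (in prob_space) integral_restrict_le_truncation:
  fixes f :: "'a \<Rightarrow> real"
  assumes f: "integrable M f" "\<And>x. 0 \<le> f x" and B: "B \<in> sets M" and "0 < C"
  shows "(\<integral>x. indicator B x * f x \<partial>M) \<le> (\<integral>x. f x - min (f x) C \<partial>M) + C * prob B"
proof -
  have [measurable]: "f \<in> borel_measurable M" using f by auto
  have i: "integrable M (\<lambda>x. f x - min (f x) C)"
    by (rule Bochner_Integration.integrable_bound[OF f(1)]) (use f \<open>0 < C\<close> in auto)
  have i2: "integrable M (\<lambda>x. C * indicator B x)"
    using B by (intro integrable_mult_right) (simp add: emeasure_eq_measure)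
  have i3: "integrable M (\<lambda>x. indicator B x * f x)"
    using integrable_real_mult_indicator[OF B f(1)] by (simp add: mult.commute)
  have "(\<integral>x. indicator B x * f x \<partial>M) \<le> (\<integral>x. (f x - min (f x) C) + C * indicator B x \<partial>M)"
    using f \<open>0 < C\<close>
    by (intro integral_mono[OF i3 Bochner_Integration.integrable_add[OF i i2]]) (auto simp: indicator_def min_def)
  also have "\<dots> = (\<integral>x. f x - min (f x) C \<partial>M) + C * prob B"
    using i i2 B by simp
  finally show ?thesis .
qed

locale orbit_weights = measure_automorphism M T for M :: "'w measure" and T +
  fixes a :: "int \<Rightarrow> real"
  assumes a_pos: "0 < a k" and sqrt_a_summable: "(\<lambda>k. sqrt (a k)) summable_on UNIV"
begin

definition root_weight_sum :: real where "root_weight_sum = (\<Sum>\<^sub>\<infinity>k\<in>UNIV. sqrt (a k))"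

definition orbit_seq :: "('w \<Rightarrow> 'k::real_normed_field) \<Rightarrow> 'w \<Rightarrow> int \<Rightarrow> real" where
  "orbit_seq f x k = sqrt (a k) * norm (f (iter k x))"

definition orbit_l2 :: "('w \<Rightarrow> 'k::real_normed_field) \<Rightarrow> 'w \<Rightarrow> real" where
  "orbit_l2 f x = l2_norm (orbit_seq f x)"

lemma root_weight_sum_nonneg: "0 \<le> root_weight_sum"
  unfolding root_weight_sum_def using a_pos by (intro infsum_nonneg) (simp add: less_imp_le)

lemma orbit_norm_eq: "orbit_norm M T a f = (\<integral>x. orbit_l2 f x \<partial>M)"
  using a_pos by (simp add: orbit_norm_def orbit_l2_def orbit_seq_def l2_norm_def power_mult_distrib less_imp_le)

lemma orbit_seq_nonneg: "0 \<le> orbit_seq f x k"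
  using a_pos[of k] by (simp add: orbit_seq_def)

lemma orbit_l2_nonneg: "0 \<le> orbit_l2 f x"
  by (simp add: orbit_l2_def l2_norm_nonneg)

lemma orbit_norm_nonneg: "0 \<le> orbit_norm M T a f"
  by (simp add: orbit_norm_eq orbit_l2_nonneg)

lemma orbit_l2_cmult: "orbit_l2 (\<lambda>x. c * f x) x = norm c * orbit_l2 f x"
proof -
  have "orbit_seq (\<lambda>x. c * f x) x = (\<lambda>k. norm c * orbit_seq f x k)"
    by (auto simp: orbit_seq_def norm_mult)
  then show ?thesis by (simp add: orbit_l2_def l2_norm_cmult)
qed

lemma orbit_l2_minus: "orbit_l2 (\<lambda>x. - f x) x = orbit_l2 f x"
  by (simp add: orbit_l2_def orbit_seq_def[abs_def])

lemma orbit_norm_cmult: "orbit_norm M T a (\<lambda>x. c * f x) = norm c * orbit_norm M T a f"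
  by (simp add: orbit_norm_eq orbit_l2_cmult)

lemma orbit_l2_cong_AE:
  assumes "AE x in M. f x = g x"
  shows "AE x in M. orbit_l2 f x = orbit_l2 g x"
  using AE_iter[OF assms] by eventually_elim (simp add: orbit_l2_def orbit_seq_def[abs_def])

lemma orbit_l2_measurable[measurable]:
  fixes f :: "'w \<Rightarrow> 'k::{real_normed_field, banach, second_countable_topology}"
  assumes [measurable]: "f \<in> borel_measurable M"
  shows "orbit_l2 f \<in> borel_measurable M"
proof -
  have "(\<lambda>x. \<Sum>\<^sub>\<infinity>k\<in>UNIV. (orbit_seq f x k)\<^sup>2) \<in> borel_measurable M"
    unfolding orbit_seq_def by (rule borel_measurable_infsum_int) auto
  then show ?thesis unfolding orbit_l2_def[abs_def] l2_norm_def by measurable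
qed

lemma orbit_norm_cong_AE:
  fixes f g :: "'w \<Rightarrow> 'k::{real_normed_field, banach, second_countable_topology}"
  assumes "AE x in M. f x = g x" "f \<in> borel_measurable M" "g \<in> borel_measurable M"
  shows "orbit_norm M T a f = orbit_norm M T a g"
  unfolding orbit_norm_eq using assms by (intro integral_cong_AE orbit_l2_cong_AE) auto

context
  fixes f :: "'w \<Rightarrow> 'k::{real_normed_field, banach, second_countable_topology}"
  assumes f: "integrable M f"
begin

lemma integrable_orbit_seq: "integrable M (\<lambda>x. orbit_seq f x k)"
  and integral_orbit_seq: "(\<integral>x. orbit_seq f x k \<partial>M) = sqrt (a k) * (\<integral>x. norm (f x) \<partial>M)"
proof -
  have [measurable]: "f \<in> borel_measurable M" using f by auto
  show "integrable M (\<lambda>x. orbit_seq f x k)"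
    unfolding orbit_seq_def using integrable_norm[OF integrable_iter[OF f]] by (rule integrable_mult_right)
  show "(\<integral>x. orbit_seq f x k \<partial>M) = sqrt (a k) * (\<integral>x. norm (f x) \<partial>M)"
    unfolding orbit_seq_def using integral_iter[of "\<lambda>x. norm (f x)" k] by simp
qed

lemma summable_integral_orbit_seq: "(\<lambda>k. \<integral>x. orbit_seq f x k \<partial>M) summable_on UNIV"
  unfolding integral_orbit_seq by (rule summable_on_cmult_left[OF sqrt_a_summable])

lemmas orbit_seq_sum = integral_infsum_int[of M "\<lambda>k x. orbit_seq f x k",
    OF integrable_orbit_seq orbit_seq_nonneg summable_integral_orbit_seq]

lemma orbit_seq_summable: "AE x in M. orbit_seq f x summable_on UNIV"
  using orbit_seq_sum(1) .

lemma integrable_orbit_l2: "integrable M (orbit_l2 f)"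
proof (rule Bochner_Integration.integrable_bound[OF orbit_seq_sum(2)])
  show "AE x in M. norm (orbit_l2 f x) \<le> norm (\<Sum>\<^sub>\<infinity>k\<in>UNIV. orbit_seq f x k)"
    using orbit_seq_summable
  proof eventually_elim
    case (elim x)
    then show ?case
      using l2_norm_le_infsum[OF orbit_seq_nonneg elim]
      by (simp add: orbit_l2_def l2_norm_nonneg)
  qed
qed (use f in auto)

lemma orbit_norm_le: "orbit_norm M T a f \<le> root_weight_sum * (\<integral>x. norm (f x) \<partial>M)"
proof -
  have "orbit_norm M T a f \<le> (\<integral>x. (\<Sum>\<^sub>\<infinity>k\<in>UNIV. orbit_seq f x k) \<partial>M)"
    unfolding orbit_norm_eq
  proof (rule integral_mono_AE[OF integrable_orbit_l2 orbit_seq_sum(2)])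
    show "AE x in M. orbit_l2 f x \<le> (\<Sum>\<^sub>\<infinity>k\<in>UNIV. orbit_seq f x k)"
      using orbit_seq_summable
      by eventually_elim (simp add: orbit_l2_def l2_norm_le_infsum orbit_seq_nonneg)
  qed
  also have "\<dots> = root_weight_sum * (\<integral>x. norm (f x) \<partial>M)"
    using orbit_seq_sum(3) by (simp add: integral_orbit_seq infsum_cmult_left' root_weight_sum_def)
  finally show ?thesis .
qed

lemma orbit_norm_ge: "sqrt (a 0) * (\<integral>x. norm (f x) \<partial>M) \<le> orbit_norm M T a f"
proof -
  have "(\<integral>x. sqrt (a 0) * norm (f x) \<partial>M) \<le> orbit_norm M T a f"
    unfolding orbit_norm_eq
  proof (rule integral_mono_AE[OF _ integrable_orbit_l2])
    show "AE x in M. sqrt (a 0) * norm (f x) \<le> orbit_l2 f x"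
      using orbit_seq_summable
    proof eventually_elim
      case (elim x)
      then have "orbit_seq f x 0 \<le> orbit_l2 f x"
        unfolding orbit_l2_def by (intro l2_norm_ge_coordinate orbit_seq_nonneg)
      then show ?case by (simp add: orbit_seq_def iter_0)
    qed
  qed (use f in auto)
  then show ?thesis by simp
qed

end

lemma orbit_l2_mono:
  fixes f g :: "'w \<Rightarrow> 'k::{real_normed_field, banach, second_countable_topology}"
  assumes "integrable M g" "\<And>x. norm (f x) \<le> norm (g x)"
  shows "AE x in M. orbit_l2 f x \<le> orbit_l2 g x"
  using orbit_seq_summable[OF assms(1)]
proof eventually_elim
  case (elim x)
  show ?case
    unfolding orbit_l2_def
    by (rule l2_norm_mono[OF orbit_seq_nonneg _ elim])
       (use assms(2) a_pos in \<open>auto simp: orbit_seq_def less_imp_le intro!: mult_left_mono\<close>)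
qed

lemma orbit_l2_triangle:
  fixes f g :: "'w \<Rightarrow> 'k::{real_normed_field, banach, second_countable_topology}"
  assumes "integrable M f" "integrable M g"
  shows "AE x in M. orbit_l2 (\<lambda>x. f x + g x) x \<le> orbit_l2 f x + orbit_l2 g x"
  using orbit_seq_summable[OF assms(1)] orbit_seq_summable[OF assms(2)]
proof eventually_elim
  case (elim x)
  have "orbit_l2 (\<lambda>x. f x + g x) x \<le> l2_norm (\<lambda>k. orbit_seq f x k + orbit_seq g x k)"
    unfolding orbit_l2_def
  proof (rule l2_norm_mono[OF orbit_seq_nonneg])
    show "orbit_seq (\<lambda>x. f x + g x) x k \<le> orbit_seq f x k + orbit_seq g x k" for k
      using a_pos[of k] by (simp add: orbit_seq_def norm_triangle_ineq flip: distrib_left)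
  qed (intro summable_on_add elim)
  also have "\<dots> \<le> orbit_l2 f x + orbit_l2 g x"
    unfolding orbit_l2_def by (intro l2_norm_triangle orbit_seq_nonneg elim)
  finally show ?case .
qed

lemma orbit_norm_triangle:
  fixes f g :: "'w \<Rightarrow> 'k::{real_normed_field, banach, second_countable_topology}"
  assumes "integrable M f" "integrable M g"
  shows "orbit_norm M T a (\<lambda>x. f x + g x) \<le> orbit_norm M T a f + orbit_norm M T a g"
proof -
  have "orbit_norm M T a (\<lambda>x. f x + g x) \<le> (\<integral>x. orbit_l2 f x + orbit_l2 g x \<partial>M)"
    unfolding orbit_norm_eq using assms
    by (intro integral_mono_AE orbit_l2_triangle) (auto intro: integrable_orbit_l2)
  then show ?thesis
    using assms by (simp add: orbit_norm_eq integrable_orbit_l2)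
qed

text \<open>Both inequalities \<open>\<Phi> u \<le> \<Phi> (u + w) + \<Phi> w\<close> and \<open>\<Phi> w \<le> \<Phi> (u + w) + \<Phi> u\<close> hold almost everywhere; the first
  is used on \<open>A\<close>, the second outside.  The error is small when \<open>\<Phi> u\<close> is concentrated on \<open>A\<close> and \<open>\<Phi> w\<close> has
  little mass there.\<close>

lemma orbit_norm_separation:
  fixes u w :: "'w \<Rightarrow> 'k::{real_normed_field, banach, second_countable_topology}"
  assumes u: "integrable M u" and w: "integrable M w" and A: "A \<in> sets M"
  shows "orbit_norm M T a u + orbit_norm M T a w \<le> orbit_norm M T a (\<lambda>x. u x + w x)
    + 2 * (\<integral>x. indicator (space M - A) x * orbit_l2 u x \<partial>M)
    + 2 * (\<integral>x. indicator A x * orbit_l2 w x \<partial>M)"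
proof -
  have uw: "integrable M (\<lambda>x. u x + w x)" using u w by simp
  note [simp] = integrable_orbit_l2[OF u] integrable_orbit_l2[OF w] integrable_orbit_l2[OF uw]
  have i: "integrable M (\<lambda>x. indicator (space M - A) x * orbit_l2 u x)"
    "integrable M (\<lambda>x. indicator A x * orbit_l2 w x)"
    using A integrable_real_mult_indicator[of "space M - A" M "orbit_l2 u"]
      integrable_real_mult_indicator[of A M "orbit_l2 w"]
    by (simp_all add: mult.commute)
  have "orbit_norm M T a u + orbit_norm M T a w = (\<integral>x. orbit_l2 u x + orbit_l2 w x \<partial>M)"
    by (simp add: orbit_norm_eq)
  also have "\<dots> \<le> (\<integral>x. orbit_l2 (\<lambda>x. u x + w x) x
      + 2 * (indicator (space M - A) x * orbit_l2 u x) + 2 * (indicator A x * orbit_l2 w x) \<partial>M)"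
  proof (rule integral_mono_AE)
    have "AE x in M. orbit_l2 u x \<le> orbit_l2 (\<lambda>x. u x + w x) x + orbit_l2 w x"
      using orbit_l2_triangle[OF uw, of "\<lambda>x. - w x"] w by (simp add: orbit_l2_minus)
    moreover have "AE x in M. orbit_l2 w x \<le> orbit_l2 (\<lambda>x. u x + w x) x + orbit_l2 u x"
      using orbit_l2_triangle[OF uw, of "\<lambda>x. - u x"] u by (simp add: orbit_l2_minus)
    ultimately show "AE x in M. orbit_l2 u x + orbit_l2 w x \<le> orbit_l2 (\<lambda>x. u x + w x) x
      + 2 * (indicator (space M - A) x * orbit_l2 u x) + 2 * (indicator A x * orbit_l2 w x)"
      using AE_space
      by eventually_elim (auto simp: indicator_def)
  qed (use i in auto)
  also have "\<dots> = orbit_norm M T a (\<lambda>x. u x + w x)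
    + 2 * (\<integral>x. indicator (space M - A) x * orbit_l2 u x \<partial>M)
    + 2 * (\<integral>x. indicator A x * orbit_l2 w x \<partial>M)"
    using i by (simp add: orbit_norm_eq)
  finally show ?thesis .
qed

end

section \<open>Splitting a function along an almost invariant partition\<close>

lemma has_sum_finite_sum:
  fixes u :: "'p \<Rightarrow> 'i \<Rightarrow> 'b::topological_comm_monoid_add"
  assumes "finite P" "\<And>p. p \<in> P \<Longrightarrow> (u p has_sum s p) A"
  shows "((\<lambda>k. \<Sum>p\<in>P. u p k) has_sum (\<Sum>p\<in>P. s p)) A"
  using assms by (induction P rule: finite_induct) (auto intro: has_sum_add)

context orbit_weights
begin

definition piece :: "('w \<Rightarrow> 'l) \<Rightarrow> ('w \<Rightarrow> 'k::real_normed_field) \<Rightarrow> 'l \<Rightarrow> 'w \<Rightarrow> 'k" where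
  "piece g f p x = (if g x = p then f x else 0)"

abbreviation level :: "('w \<Rightarrow> 'l) \<Rightarrow> 'l \<Rightarrow> 'w set" where
  "level g p \<equiv> {x\<in>space M. g x = p}"

abbreviation crossing :: "('w \<Rightarrow> 'l) \<Rightarrow> int \<Rightarrow> 'w set" where
  "crossing g k \<equiv> {x\<in>space M. g (iter k x) \<noteq> g x}"

lemma crossing_sets:
  fixes g :: "'w \<Rightarrow> 'l::countable"
  assumes [measurable]: "g \<in> measurable M (count_space UNIV)"
  shows "crossing g k \<in> sets M"
proof -
  have "Measurable.pred M (\<lambda>x. g (iter k x) = g x)"
    by (rule pred_eq_countable) measurable
  then show ?thesis by measurable
qed

lemma integrable_piece:
  fixes g :: "'w \<Rightarrow> 'l::countable"
    and f :: "'w \<Rightarrow> 'k::{real_normed_field, banach, second_countable_topology}"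
  assumes [measurable]: "g \<in> measurable M (count_space UNIV)" and f: "integrable M f"
  shows "integrable M (piece g f p)"
proof (rule Bochner_Integration.integrable_bound[OF f])
  have [measurable]: "f \<in> borel_measurable M" using f by auto
  show "piece g f p \<in> borel_measurable M"
    unfolding piece_def[abs_def] by measurable
qed (auto simp: piece_def)

text \<open>Three errors of size \<open>e / 3\<close>: all but finitely many \<open>k\<close> are discarded by the summability of \<open>\<surd>(a k)\<close>;
  for the remaining \<open>k\<close> the function \<open>f\<close> is truncated at height \<open>C\<close>; and the truncated part is controlled
  by the measure of the points whose label differs from that of their \<open>k\<close>-th iterate.\<close>

lemma crossing_integral_small:
  fixes f :: "'w \<Rightarrow> 'k::{real_normed_field, banach, second_countable_topology}"
  assumes f: "integrable M f" and "0 < e"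
  shows "\<exists>d>0. \<forall>g :: 'w \<Rightarrow> 'l::countable. g \<in> measurable M (count_space UNIV) \<longrightarrow>
    measure M {x\<in>space M. g (T x) \<noteq> g x} \<le> d \<longrightarrow>
    (\<Sum>\<^sub>\<infinity>k\<in>UNIV. \<integral>x. indicator (crossing g k) x * orbit_seq f x k \<partial>M) \<le> e"
proof -
  have [measurable]: "f \<in> borel_measurable M" using f by auto
  define L where "L = (\<integral>x. norm (f x) \<partial>M)"
  have L: "0 \<le> L" by (simp add: L_def)
  obtain F where F: "finite F" "dist (\<Sum>k\<in>F. sqrt (a k)) root_weight_sum \<le> e / (3 * (L + 1))"
    using infsum_finite_approximation[OF sqrt_a_summable, of "e / (3 * (L + 1))"] \<open>0 < e\<close> L
    by (auto simp: root_weight_sum_def)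
  obtain C where C: "0 < C" "(\<integral>x. norm (f x) - min (norm (f x)) C \<partial>M) \<le> e / (3 * (root_weight_sum + 1))"
    using integrable_truncation[OF integrable_norm[OF f], of "e / (3 * (root_weight_sum + 1))"] \<open>0 < e\<close> root_weight_sum_nonneg by auto
  define S where "S = (\<Sum>k\<in>F. sqrt (a k) * \<bar>real_of_int k\<bar>)"
  have S: "0 \<le> S" using a_pos by (auto simp: S_def less_imp_le intro!: sum_nonneg)
  define d where "d = e / (3 * (C * S + 1))"
  have d: "0 < d" using \<open>0 < e\<close> C S by (auto simp: d_def intro!: divide_pos_pos add_nonneg_pos)
  show ?thesis
  proof (intro exI[of _ d] conjI d allI impI)
    fix g :: "'w \<Rightarrow> 'l"
    assume g: "g \<in> measurable M (count_space UNIV)" and gd: "measure M {x\<in>space M. g (T x) \<noteq> g x} \<le> d"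
    define t where "t k = (\<integral>x. indicator (crossing g k) x * norm (f (iter k x)) \<partial>M)" for k
    have eq: "(\<integral>x. indicator (crossing g k) x * orbit_seq f x k \<partial>M) = sqrt (a k) * t k" for k
    proof -
      have "(\<lambda>x. indicator (crossing g k) x * orbit_seq f x k)
          = (\<lambda>x. sqrt (a k) * (indicator (crossing g k) x * norm (f (iter k x))))"
        by (auto simp: orbit_seq_def)
      then show ?thesis by (simp add: t_def)
    qed
    have i: "integrable M (\<lambda>x. norm (f (iter k x)))" for k
      by (intro integrable_norm integrable_iter f)
    have t_nonneg: "0 \<le> t k" for k by (simp add: t_def)
    have t_le_L: "t k \<le> L" for k
    proof -
      have "t k \<le> (\<integral>x. norm (f (iter k x)) \<partial>M)"
        unfolding t_def
      proof (rule integral_mono[OF _ i])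
        show "integrable M (\<lambda>x. indicator (crossing g k) x * norm (f (iter k x)))"
          using integrable_real_mult_indicator[OF crossing_sets[OF g] i] by (simp add: mult.commute)
      qed (auto simp: indicator_def)
      also have "\<dots> = L" unfolding L_def by (rule integral_iter) auto
      finally show ?thesis .
    qed
    have t_le: "t k \<le> e / (3 * (root_weight_sum + 1)) + C * (\<bar>real_of_int k\<bar> * d)" for k
    proof -
      have "t k \<le> (\<integral>x. norm (f (iter k x)) - min (norm (f (iter k x))) C \<partial>M) + C * prob (crossing g k)"
        unfolding t_def
        by (rule integral_restrict_le_truncation[OF i _ crossing_sets[OF g] C(1)]) auto
      also have "(\<integral>x. norm (f (iter k x)) - min (norm (f (iter k x))) C \<partial>M)
          = (\<integral>x. norm (f x) - min (norm (f x)) C \<partial>M)"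
        by (rule integral_iter[where f = "\<lambda>x. norm (f x) - min (norm (f x)) C"]) auto
      also have "\<dots> \<le> e / (3 * (root_weight_sum + 1))" by (rule C)
      also have "prob (crossing g k) \<le> \<bar>real_of_int k\<bar> * d"
        using measure_label_change_le[OF g, of k] mult_left_mono[OF gd, of "\<bar>real_of_int k\<bar>"] by linarith
      finally show ?thesis using C by simp
    qed
    have sum_t: "(\<lambda>k. sqrt (a k) * t k) summable_on UNIV"
      by (rule summable_on_comparison_test[OF summable_on_cmult_left[OF sqrt_a_summable, of L]])
         (use a_pos t_nonneg t_le_L in \<open>auto simp: less_imp_le intro!: mult_left_mono\<close>)
    have "(\<Sum>\<^sub>\<infinity>k\<in>UNIV. sqrt (a k) * t k)
        = (\<Sum>k\<in>F. sqrt (a k) * t k) + (\<Sum>\<^sub>\<infinity>k\<in>UNIV - F. sqrt (a k) * t k)"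
      using infsum_Un_disjoint[of "\<lambda>k. sqrt (a k) * t k" F "UNIV - F"] F sum_t
      by (simp add: summable_on_cofin_subset)
    also have "(\<Sum>\<^sub>\<infinity>k\<in>UNIV - F. sqrt (a k) * t k) \<le> (\<Sum>\<^sub>\<infinity>k\<in>UNIV - F. sqrt (a k) * L)"
      by (rule infsum_mono)
         (use F sum_t sqrt_a_summable a_pos t_le_L in
          \<open>auto simp: less_imp_le intro!: summable_on_cofin_subset summable_on_cmult_left mult_left_mono\<close>)
    also have "\<dots> = (root_weight_sum - (\<Sum>k\<in>F. sqrt (a k))) * L"
      using infsum_Un_disjoint[of "\<lambda>k. sqrt (a k)" F "UNIV - F"] F sqrt_a_summable
      by (simp add: summable_on_cofin_subset infsum_cmult_left' root_weight_sum_def)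
    also have "\<dots> \<le> e / (3 * (L + 1)) * (L + 1)"
      using F L \<open>0 < e\<close> by (intro mult_mono) (auto simp: dist_real_def)
    also have "\<dots> = e / 3" using L by (simp add: field_simps)
    also have "(\<Sum>k\<in>F. sqrt (a k) * t k)
        \<le> (\<Sum>k\<in>F. sqrt (a k) * (e / (3 * (root_weight_sum + 1)) + C * (\<bar>real_of_int k\<bar> * d)))"
      using a_pos t_le by (intro sum_mono mult_left_mono) (auto simp: less_imp_le)
    also have "\<dots> = (\<Sum>k\<in>F. sqrt (a k)) * (e / (3 * (root_weight_sum + 1))) + (C * S) * d"
      by (simp add: S_def distrib_left sum.distrib sum_distrib_left sum_distrib_right sum_divide_distrib mult_ac)
    also have "(\<Sum>k\<in>F. sqrt (a k)) * (e / (3 * (root_weight_sum + 1))) \<le> (root_weight_sum + 1) * (e / (3 * (root_weight_sum + 1)))"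
    proof (rule mult_right_mono)
      have "(\<Sum>k\<in>F. sqrt (a k)) \<le> root_weight_sum"
        unfolding root_weight_sum_def using F a_pos by (intro finite_sum_le_infsum sqrt_a_summable) (auto simp: less_imp_le)
      then show "(\<Sum>k\<in>F. sqrt (a k)) \<le> root_weight_sum + 1" by simp
    qed (use \<open>0 < e\<close> root_weight_sum_nonneg in auto)
    also have "\<dots> = e / 3" using root_weight_sum_nonneg by (simp add: field_simps)
    also have "C * S * d \<le> (C * S + 1) * d" using d by simp
    also have "\<dots> = e / 3"
    proof -
      have "0 \<le> C * S" using C S by simp
      then have "C * S + 1 \<noteq> 0" by linarith
      then show ?thesis by (simp add: d_def field_simps)
    qed
    finally show "(\<Sum>\<^sub>\<infinity>k\<in>UNIV. \<integral>x. indicator (crossing g k) x * orbit_seq f x k \<partial>M) \<le> e"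
      unfolding eq by simp
  qed
qed

text \<open>At a point \<open>x\<close> outside the level of \<open>p\<close>, the piece \<open>p\<close> is seen only at those \<open>k\<close> for which \<open>T\<^sup>k x\<close> has the
  label \<open>p\<close>, and there \<open>x\<close> and \<open>T\<^sup>k x\<close> have different labels.  Each \<open>k\<close> is charged to a single \<open>p\<close>.\<close>

lemma piece_leakage_le:
  fixes f :: "'w \<Rightarrow> 'k::{real_normed_field, banach, second_countable_topology}"
    and g :: "'w \<Rightarrow> 'l::countable"
  assumes f: "integrable M f" and g[measurable]: "g \<in> measurable M (count_space UNIV)" and P: "finite P"
  shows "(\<Sum>p\<in>P. \<integral>x. indicator (space M - level g p) x * orbit_l2 (piece g f p) x \<partial>M)
    \<le> (\<Sum>\<^sub>\<infinity>k\<in>UNIV. \<integral>x. indicator (crossing g k) x * orbit_seq f x k \<partial>M)"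
proof -
  define E where "E p k = {x\<in>space M. g x \<noteq> p \<and> g (iter k x) = p}" for p k
  have E[measurable]: "E p k \<in> sets M" for p k unfolding E_def by measurable
  define w where "w p k x = indicator (E p k) x * orbit_seq f x k" for p k x
  have w_nonneg: "0 \<le> w p k x" for p k x by (simp add: w_def orbit_seq_nonneg)
  have w_int: "integrable M (w p k)" for p k
    unfolding w_def[abs_def]
    using integrable_real_mult_indicator[OF E integrable_orbit_seq[OF f]] by (simp add: mult.commute)
  have w_sum: "(\<lambda>k. \<integral>x. w p k x \<partial>M) summable_on UNIV" for p
  proof (rule summable_on_comparison_test[OF summable_integral_orbit_seq[OF f]])
    show "(\<integral>x. w p k x \<partial>M) \<le> (\<integral>x. orbit_seq f x k \<partial>M)" for k
      by (rule integral_mono[OF w_int integrable_orbit_seq[OF f]])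
         (auto simp: w_def indicator_def orbit_seq_nonneg)
  qed (simp add: w_nonneg)
  note w = integral_infsum_int[of M "w _", OF w_int w_nonneg w_sum]
  have one: "(\<integral>x. indicator (space M - level g p) x * orbit_l2 (piece g f p) x \<partial>M)
      \<le> (\<Sum>\<^sub>\<infinity>k\<in>UNIV. \<integral>x. w p k x \<partial>M)" for p
    unfolding w(3)[symmetric]
  proof (rule integral_mono_AE[OF _ w(2)])
    have "level g p \<in> sets M" by measurable
    then show "integrable M (\<lambda>x. indicator (space M - level g p) x * orbit_l2 (piece g f p) x)"
      using integrable_real_mult_indicator[of "space M - level g p" M,
          OF _ integrable_orbit_l2[OF integrable_piece[OF g f]]]
      by (simp add: mult.commute)
    show "AE x in M. indicator (space M - level g p) x * orbit_l2 (piece g f p) x \<le> (\<Sum>\<^sub>\<infinity>k\<in>UNIV. w p k x)"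
      using orbit_seq_summable[OF integrable_piece[OF g f, of p]] AE_space
    proof eventually_elim
      case (elim x)
      show ?case
      proof (cases "g x = p")
        case True
        then show ?thesis using elim by (simp add: infsum_nonneg w_nonneg)
      next
        case False
        then have "orbit_seq (piece g f p) x = (\<lambda>k. w p k x)"
          using elim iter_space[OF elim(2)]
          by (auto simp: orbit_seq_def w_def E_def piece_def indicator_def)
        then show ?thesis
          using False elim l2_norm_le_infsum[OF orbit_seq_nonneg elim(1)] by (simp add: orbit_l2_def)
      qed
    qed
  qed
  have "(\<Sum>p\<in>P. \<integral>x. indicator (space M - level g p) x * orbit_l2 (piece g f p) x \<partial>M)
      \<le> (\<Sum>p\<in>P. \<Sum>\<^sub>\<infinity>k\<in>UNIV. \<integral>x. w p k x \<partial>M)"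
    by (intro sum_mono one)
  also have sum: "((\<lambda>k. \<Sum>p\<in>P. \<integral>x. w p k x \<partial>M) has_sum (\<Sum>p\<in>P. \<Sum>\<^sub>\<infinity>k\<in>UNIV. \<integral>x. w p k x \<partial>M)) UNIV"
    using P w_sum by (intro has_sum_finite_sum has_sum_infsum)
  have "(\<Sum>p\<in>P. \<Sum>\<^sub>\<infinity>k\<in>UNIV. \<integral>x. w p k x \<partial>M) = (\<Sum>\<^sub>\<infinity>k\<in>UNIV. \<Sum>p\<in>P. \<integral>x. w p k x \<partial>M)"
    using infsumI[OF sum] by simp
  also have "\<dots> \<le> (\<Sum>\<^sub>\<infinity>k\<in>UNIV. \<integral>x. indicator (crossing g k) x * orbit_seq f x k \<partial>M)"
  proof (rule infsum_mono)
    have c_int: "integrable M (\<lambda>x. indicator (crossing g k) x * orbit_seq f x k)" for k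
      using integrable_real_mult_indicator[OF crossing_sets[OF g] integrable_orbit_seq[OF f]]
      by (simp add: mult.commute)
    show "(\<lambda>k. \<Sum>p\<in>P. \<integral>x. w p k x \<partial>M) summable_on UNIV"
      using sum by (auto simp: summable_on_def)
    show "(\<lambda>k. \<integral>x. indicator (crossing g k) x * orbit_seq f x k \<partial>M) summable_on UNIV"
    proof (rule summable_on_comparison_test[OF summable_integral_orbit_seq[OF f]])
      show "(\<integral>x. indicator (crossing g k) x * orbit_seq f x k \<partial>M) \<le> (\<integral>x. orbit_seq f x k \<partial>M)" for k
        by (rule integral_mono[OF c_int integrable_orbit_seq[OF f]])
           (auto simp: indicator_def orbit_seq_nonneg)
    qed (simp add: orbit_seq_nonneg)
    show "(\<Sum>p\<in>P. \<integral>x. w p k x \<partial>M) \<le> (\<integral>x. indicator (crossing g k) x * orbit_seq f x k \<partial>M)" for k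
    proof -
      have "(\<Sum>p\<in>P. \<integral>x. w p k x \<partial>M) = (\<integral>x. (\<Sum>p\<in>P. w p k x) \<partial>M)"
        using w_int by simp
      also have "\<dots> \<le> (\<integral>x. indicator (crossing g k) x * orbit_seq f x k \<partial>M)"
      proof (rule integral_mono[OF _ c_int])
        fix x assume x: "x \<in> space M"
        have "(\<Sum>p\<in>P. w p k x) = (\<Sum>p\<in>P. indicator {g (iter k x)} p * (indicator (crossing g k) x * orbit_seq f x k))"
          using x by (intro sum.cong) (auto simp: w_def E_def indicator_def)
        also have "\<dots> = (\<Sum>p\<in>P. indicator {g (iter k x)} p) * (indicator (crossing g k) x * orbit_seq f x k)"
          by (simp add: sum_distrib_right)
        also have "\<dots> \<le> 1 * (indicator (crossing g k) x * orbit_seq f x k)"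
          using card_mono[of "{g (iter k x)}" "P \<inter> {g (iter k x)}"] P
          by (intro mult_right_mono) (auto simp: orbit_seq_nonneg indicator_def)
        finally show "(\<Sum>p\<in>P. w p k x) \<le> indicator (crossing g k) x * orbit_seq f x k" by simp
      qed (use w_int in auto)
      finally show ?thesis .
    qed
  qed
  finally show ?thesis .
qed

text \<open>On its own level a piece satisfies \<open>\<Phi> f\<^sub>p \<le> \<Phi> f\<close>, and the levels are disjoint; what is left is the
  leakage.\<close>

lemma sum_orbit_norm_pieces_le:
  fixes f :: "'w \<Rightarrow> 'k::{real_normed_field, banach, second_countable_topology}"
    and g :: "'w \<Rightarrow> 'l::countable"
  assumes f: "integrable M f" and g[measurable]: "g \<in> measurable M (count_space UNIV)" and P: "finite P"
  shows "(\<Sum>p\<in>P. orbit_norm M T a (piece g f p)) \<le> orbit_norm M T a f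
    + (\<Sum>p\<in>P. \<integral>x. indicator (space M - level g p) x * orbit_l2 (piece g f p) x \<partial>M)"
proof -
  have lev: "level g p \<in> sets M" for p by measurable
  have ind: "integrable M (\<lambda>x. indicator A x * h x)" if "A \<in> sets M" "integrable M h" for A and h :: "'w \<Rightarrow> real"
    using integrable_real_mult_indicator[OF that] by (simp add: mult.commute)
  note pf = integrable_orbit_l2[OF integrable_piece[OF g f]]
  note i1 = ind[OF lev integrable_orbit_l2[OF f]]
  have i2: "integrable M (\<lambda>x. indicator (space M - level g p) x * orbit_l2 (piece g f p) x)" for p
    using lev by (intro ind pf) auto
  have "orbit_norm M T a (piece g f p) \<le> (\<integral>x. indicator (level g p) x * orbit_l2 f x \<partial>M)
      + (\<integral>x. indicator (space M - level g p) x * orbit_l2 (piece g f p) x \<partial>M)" for p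
  proof -
    have "orbit_norm M T a (piece g f p) \<le> (\<integral>x. indicator (level g p) x * orbit_l2 f x
      + indicator (space M - level g p) x * orbit_l2 (piece g f p) x \<partial>M)"
      unfolding orbit_norm_eq
    proof (rule integral_mono_AE[OF pf])
      have "AE x in M. orbit_l2 (piece g f p) x \<le> orbit_l2 f x"
        by (rule orbit_l2_mono[OF f]) (simp add: piece_def)
      then show "AE x in M. orbit_l2 (piece g f p) x \<le> indicator (level g p) x * orbit_l2 f x
          + indicator (space M - level g p) x * orbit_l2 (piece g f p) x"
        using AE_space by eventually_elim (auto simp: indicator_def)
    qed (intro Bochner_Integration.integrable_add i1 i2)
    then show ?thesis using i1 i2 by simp
  qed
  then have "(\<Sum>p\<in>P. orbit_norm M T a (piece g f p)) \<le> (\<Sum>p\<in>P. \<integral>x. indicator (level g p) x * orbit_l2 f x \<partial>M)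
      + (\<Sum>p\<in>P. \<integral>x. indicator (space M - level g p) x * orbit_l2 (piece g f p) x \<partial>M)"
    by (simp add: sum_mono flip: sum.distrib)
  also have "(\<Sum>p\<in>P. \<integral>x. indicator (level g p) x * orbit_l2 f x \<partial>M)
      = (\<integral>x. (\<Sum>p\<in>P. indicator (level g p) x * orbit_l2 f x) \<partial>M)"
    using i1 by simp
  also have "\<dots> \<le> orbit_norm M T a f"
    unfolding orbit_norm_eq
  proof (rule integral_mono[OF _ integrable_orbit_l2[OF f]])
    fix x assume "x \<in> space M"
    then have "(\<Sum>p\<in>P. indicator (level g p) x * orbit_l2 f x) = (\<Sum>p\<in>P. if p = g x then orbit_l2 f x else 0)"
      by (intro sum.cong) (auto simp: indicator_def)
    then show "(\<Sum>p\<in>P. indicator (level g p) x * orbit_l2 f x) \<le> orbit_l2 f x"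
      using P by (simp add: sum.delta orbit_l2_nonneg)
  qed (use i1 in auto)
  finally show ?thesis by simp
qed

lemma orbit_splitting:
  fixes f h :: "'w \<Rightarrow> 'k::{real_normed_field, banach, second_countable_topology}"
  assumes "atomless M" and f: "integrable M f" and h: "integrable M h" and "0 < e"
  shows "\<exists>(g :: 'w \<Rightarrow> nat \<times> nat) P. g \<in> measurable M (count_space UNIV) \<and> finite P \<and>
    (\<forall>x\<in>space M. g x \<in> P) \<and>
    (\<Sum>p\<in>P. \<integral>x. indicator (space M - level g p) x * orbit_l2 (piece g f p) x \<partial>M) \<le> e \<and>
    (\<Sum>p\<in>P. orbit_norm M T a (piece g f p)) \<le> orbit_norm M T a f + e \<and>
    (\<forall>p. (\<integral>x. indicator (level g p) x * orbit_l2 h x \<partial>M) \<le> e)"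
proof -
  obtain d where d: "0 < d" "\<And>g :: 'w \<Rightarrow> nat \<times> nat. g \<in> measurable M (count_space UNIV) \<Longrightarrow>
    measure M {x\<in>space M. g (T x) \<noteq> g x} \<le> d \<Longrightarrow>
    (\<Sum>\<^sub>\<infinity>k\<in>UNIV. \<integral>x. indicator (crossing g k) x * orbit_seq f x k \<partial>M) \<le> e"
    using crossing_integral_small[OF f \<open>0 < e\<close>] by blast
  obtain C where C: "0 < C" "(\<integral>x. orbit_l2 h x - min (orbit_l2 h x) C \<partial>M) \<le> e / 2"
    using integrable_truncation[OF integrable_orbit_l2[OF h], of "e / 2"] \<open>0 < e\<close> orbit_l2_nonneg by auto
  have "0 < min d (e / (2 * C))" using d C \<open>0 < e\<close> by simp
  from almost_invariant_labels[OF assms(1) this]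
  obtain g :: "'w \<Rightarrow> nat \<times> nat" and P
    where g[measurable]: "g \<in> measurable M (count_space UNIV)" and P: "finite P" "\<forall>x\<in>space M. g x \<in> P"
      and lev: "\<And>p. prob (level g p) \<le> e / (2 * C)"
      and inv: "prob {x\<in>space M. g (T x) \<noteq> g x} \<le> d"
    by auto
  have leak: "(\<Sum>p\<in>P. \<integral>x. indicator (space M - level g p) x * orbit_l2 (piece g f p) x \<partial>M) \<le> e"
    using piece_leakage_le[OF f g P(1)] d(2)[OF g inv] by linarith
  have "(\<integral>x. indicator (level g p) x * orbit_l2 h x \<partial>M) \<le> e" for p
  proof -
    have "(\<integral>x. indicator (level g p) x * orbit_l2 h x \<partial>M) \<le> e / 2 + C * prob (level g p)"
      using integral_restrict_le_truncation[OF integrable_orbit_l2[OF h] orbit_l2_nonneg _ C(1), of "level g p"] C(2)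
      by simp
    also have "C * prob (level g p) \<le> C * (e / (2 * C))"
      using lev[of p] C by (intro mult_left_mono) auto
    also have "\<dots> = e / 2" using C by simp
    finally show ?thesis by simp
  qed
  then show ?thesis
    using g P leak sum_orbit_norm_pieces_le[OF f g P(1)]
    by (intro exI[of _ g] exI[of _ P]) auto
qed

end

section \<open>A sufficient condition for the Daugavet property\<close>

lemma normed_space_linear_finsum_le:
  fixes E :: "('k::real_normed_field, 'x) normed_module"
  assumes E: "normed_space E" and R: "linear_operator E R"
    and P: "finite P" and Z: "Z \<in> P \<rightarrow> carrier E"
  shows "nrm E (R (\<Oplus>\<^bsub>E\<^esub>p\<in>P. Z p)) \<le> (\<Sum>p\<in>P. nrm E (R (Z p)))"
proof -
  interpret Module.module "ring_of_type_algebra :: 'k ring" E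
    using E by (simp add: normed_space_def)
  have R_closed: "R x \<in> carrier E" if "x \<in> carrier E" for x
    using R that by (auto simp: linear_operator_def)
  have R_add: "R (x \<oplus>\<^bsub>E\<^esub> y) = R x \<oplus>\<^bsub>E\<^esub> R y" if "x \<in> carrier E" "y \<in> carrier E" for x y
    using R that by (auto simp: linear_operator_def)
  have "R \<zero>\<^bsub>E\<^esub> \<oplus>\<^bsub>E\<^esub> R \<zero>\<^bsub>E\<^esub> = R \<zero>\<^bsub>E\<^esub>"
    by (simp flip: R_add)
  then have R_zero: "R \<zero>\<^bsub>E\<^esub> = \<zero>\<^bsub>E\<^esub>"
    using R_closed[of "\<zero>\<^bsub>E\<^esub>"] by (metis M.add.l_cancel_one M.zero_closed)
  show ?thesis
    using P Z
  proof (induction P rule: finite_induct)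
    case empty
    have "nrm E \<zero>\<^bsub>E\<^esub> = 0" using E M.zero_closed unfolding normed_space_def by blast
    then show ?case by (simp add: R_zero)
  next
    case (insert p P)
    then have Z: "Z \<in> P \<rightarrow> carrier E" "Z p \<in> carrier E" by auto
    have "nrm E (R (\<Oplus>\<^bsub>E\<^esub>q\<in>insert p P. Z q)) = nrm E (R (Z p) \<oplus>\<^bsub>E\<^esub> R (\<Oplus>\<^bsub>E\<^esub>q\<in>P. Z q))"
      using insert.hyps Z by (simp add: R_add)
    also have "\<dots> \<le> nrm E (R (Z p)) + nrm E (R (\<Oplus>\<^bsub>E\<^esub>q\<in>P. Z q))"
      using E Z R_closed by (simp add: normed_space_def)
    also have "\<dots> \<le> nrm E (R (Z p)) + (\<Sum>p\<in>P. nrm E (R (Z p)))"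
      using insert.IH Z by simp
    finally show ?case using insert.hyps by simp
  qed
qed

lemma bdd_above_operator_norm:
  fixes E :: "('k::real_normed_field, 'x) normed_module"
  assumes "normed_space E" "bounded_operator E R"
  shows "bdd_above ((\<lambda>x. nrm E (R x)) ` {x \<in> carrier E. nrm E x \<le> 1})"
proof -
  obtain C where C: "\<And>x. x \<in> carrier E \<Longrightarrow> nrm E (R x) \<le> C * nrm E x"
    using assms(2) by (auto simp: bounded_operator_def)
  show ?thesis
  proof (rule bdd_aboveI2[of _ _ "\<bar>C\<bar>"])
    fix x assume x: "x \<in> {x \<in> carrier E. nrm E x \<le> 1}"
    then have "0 \<le> nrm E x" using assms(1) by (simp add: normed_space_def)
    have "nrm E (R x) \<le> C * nrm E x" using x C by simp
    also have "\<dots> \<le> \<bar>C\<bar> * 1"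
      using x \<open>0 \<le> nrm E x\<close> by (intro mult_mono) auto
    finally show "nrm E (R x) \<le> \<bar>C\<bar>" by simp
  qed
qed

lemma nrm_le_operator_norm:
  fixes E :: "('k::real_normed_field, 'x) normed_module"
  assumes E: "normed_space E" and R: "bounded_operator E R" and x: "x \<in> carrier E"
  shows "nrm E (R x) \<le> operator_norm E R * nrm E x"
proof (cases "nrm E x = 0")
  case True
  then show ?thesis using R x by (auto simp: bounded_operator_def)
next
  case False
  interpret Module.module "ring_of_type_algebra :: 'k ring" E
    using E by (simp add: normed_space_def)
  have pos: "0 < nrm E x" using E x False by (simp add: normed_space_def order_less_le)
  let ?c = "of_real (1 / nrm E x) :: 'k"
  have c: "norm ?c = 1 / nrm E x" using pos by (simp add: norm_divide)
  have cx: "?c \<odot>\<^bsub>E\<^esub> x \<in> carrier E"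
    using x by (intro smult_closed) (auto simp: ring_of_type_algebra_def)
  have smult: "nrm E (?c \<odot>\<^bsub>E\<^esub> v) = 1 / nrm E x * nrm E v" if "v \<in> carrier E" for v
    using E that c unfolding normed_space_def by metis
  have "nrm E (?c \<odot>\<^bsub>E\<^esub> x) = 1" using smult[OF x] pos by simp
  then have "nrm E (R (?c \<odot>\<^bsub>E\<^esub> x)) \<le> operator_norm E R"
    unfolding operator_norm_def using cx by (intro cSUP_upper bdd_above_operator_norm E R) auto
  moreover have "R (?c \<odot>\<^bsub>E\<^esub> x) = ?c \<odot>\<^bsub>E\<^esub> R x" "R x \<in> carrier E"
    using R x by (auto simp: bounded_operator_def linear_operator_def)
  ultimately have "(1 / nrm E x) * nrm E (R x) \<le> operator_norm E R"
    using smult by simp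
  then show ?thesis using pos by (simp add: field_simps)
qed

text \<open>The abstract form of the localisation: \<open>Z p\<close> are the pieces of \<open>x\<close>, \<open>e p\<close> is the leakage of \<open>Z p\<close>, and the
  last clause says that the piece almost adds up with all multiples of \<open>y\<close>.  The index type is fixed,
  since a definition cannot quantify over types; it is the type of the labels.\<close>

definition daugavet_splitting :: "('k::real_normed_field, 'x) normed_module \<Rightarrow> bool" where
  "daugavet_splitting E \<longleftrightarrow>
     (\<forall>x\<in>carrier E. \<forall>y\<in>carrier E. \<forall>\<epsilon>>0. \<exists>P :: (nat \<times> nat) set. \<exists>Z e.
        finite P \<and> Z \<in> P \<rightarrow> carrier E \<and> x = (\<Oplus>\<^bsub>E\<^esub>p\<in>P. Z p) \<and>
        (\<Sum>p\<in>P. e p) \<le> \<epsilon> \<and> (\<Sum>p\<in>P. nrm E (Z p)) \<le> nrm E x + \<epsilon> \<and>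
        (\<forall>p\<in>P. 0 \<le> e p \<and> (\<forall>c. nrm E (Z p) + nrm E (c \<odot>\<^bsub>E\<^esub> y)
           \<le> nrm E (Z p \<oplus>\<^bsub>E\<^esub> c \<odot>\<^bsub>E\<^esub> y) + 2 * e p + 2 * (norm c * \<epsilon>))))"

text \<open>If every piece violated the inequality asked of it, summation would
  contradict \<open>\<rho> < \<parallel>R x\<parallel>\<close>.  The leakage \<open>e p\<close> enters the inequality, so that it is measured relative to
  the norm of the chosen piece, however small that is.\<close>

lemma daugavet_lower_bound:
  fixes E :: "('k::real_normed_field, 'x) normed_module"
  assumes E: "normed_space E" and split: "daugavet_splitting E"
    and R: "bounded_operator E R" and rank: "rank_one E R"
    and x: "x \<in> carrier E" "nrm E x \<le> 1" and \<rho>: "0 \<le> \<rho>" "\<rho> < nrm E (R x)"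
  shows "\<exists>u\<in>carrier E. nrm E u \<le> 1 \<and> 1 + \<rho> \<le> nrm E (u \<oplus>\<^bsub>E\<^esub> R u)"
proof -
  interpret Module.module "ring_of_type_algebra :: 'k ring" E
    using E by (simp add: normed_space_def)
  have nrm_nonneg: "0 \<le> nrm E v" if "v \<in> carrier E" for v
    using E that by (simp add: normed_space_def)
  have nrm_smult: "nrm E (c \<odot>\<^bsub>E\<^esub> v) = norm c * nrm E v" if "v \<in> carrier E" for c v
    using E that by (simp add: normed_space_def)
  have smult_closed': "c \<odot>\<^bsub>E\<^esub> v \<in> carrier E" if "v \<in> carrier E" for c v
    using that by (intro smult_closed) (auto simp: ring_of_type_algebra_def)
  have lin: "linear_operator E R" using R by (simp add: bounded_operator_def)
  have R_closed: "R v \<in> carrier E" if "v \<in> carrier E" for v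
    using lin that by (auto simp: linear_operator_def)
  obtain y where y: "y \<in> carrier E" "y \<noteq> \<zero>\<^bsub>E\<^esub>" "R ` carrier E = range (\<lambda>c. c \<odot>\<^bsub>E\<^esub> y)"
    using rank by (auto simp: rank_one_def)
  define N where "N = nrm E y"
  have N: "0 < N" using E y nrm_nonneg[OF y(1)] by (auto simp: normed_space_def order_less_le N_def)
  define L where "L = operator_norm E R"
  have L: "0 \<le> L"
  proof -
    have "0 < L * nrm E x"
      using \<rho> nrm_le_operator_norm[OF E R x(1)] by (simp add: L_def)
    then show ?thesis using nrm_nonneg[OF x(1)] by (simp add: zero_less_mult_iff)
  qed
  \<comment> \<open>For a piece of norm \<open>n\<close> with \<open>R (Z p) = c y\<close> one has \<open>\<bar>c\<bar> N \<le> L n\<close>, so the error \<open>2 \<bar>c\<bar> \<epsilon>\<close> is at most \<open>B \<epsilon> n\<close>.\<close>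
  define B where "B = 2 * L / N"
  have B: "0 \<le> B" using L N by (simp add: B_def)
  have "((\<lambda>\<epsilon>. (\<rho> + B * \<epsilon>) * (1 + \<epsilon>) + 2 * \<epsilon>) \<longlongrightarrow> (\<rho> + B * 0) * (1 + 0) + 2 * 0) (at_right 0)"
    by (intro tendsto_intros)
  then have "\<forall>\<^sub>F \<epsilon> in at_right 0. (\<rho> + B * \<epsilon>) * (1 + \<epsilon>) + 2 * \<epsilon> < nrm E (R x)"
    by (rule order_tendstoD(2)) (use \<rho> in simp)
  then have "\<forall>\<^sub>F \<epsilon> in at_right 0. (\<rho> + B * \<epsilon>) * (1 + \<epsilon>) + 2 * \<epsilon> < nrm E (R x) \<and> 0 < \<epsilon>"
    using eventually_at_right_less[of "0::real"] by eventually_elim simp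
  then obtain \<epsilon> where room: "(\<rho> + B * \<epsilon>) * (1 + \<epsilon>) + 2 * \<epsilon> < nrm E (R x)" and \<epsilon>: "0 < \<epsilon>"
    by (auto dest: eventually_happens simp: trivial_limit_at_right_real)
  obtain P :: "(nat \<times> nat) set" and Z e where P: "finite P" and Z: "Z \<in> P \<rightarrow> carrier E" and xZ: "x = (\<Oplus>\<^bsub>E\<^esub>p\<in>P. Z p)"
    and e: "(\<Sum>p\<in>P. e p) \<le> \<epsilon>" and nZ: "(\<Sum>p\<in>P. nrm E (Z p)) \<le> nrm E x + \<epsilon>"
    and sep: "\<And>p c. p \<in> P \<Longrightarrow> nrm E (Z p) + nrm E (c \<odot>\<^bsub>E\<^esub> y)
           \<le> nrm E (Z p \<oplus>\<^bsub>E\<^esub> c \<odot>\<^bsub>E\<^esub> y) + 2 * e p + 2 * (norm c * \<epsilon>)"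
    and e0: "\<And>p. p \<in> P \<Longrightarrow> 0 \<le> e p"
    using split x(1) y(1) \<epsilon> unfolding daugavet_splitting_def by metis
  have Zp: "Z p \<in> carrier E" if "p \<in> P" for p using Z that by auto
  have "\<exists>p\<in>P. 0 < nrm E (Z p) \<and> (\<rho> + B * \<epsilon>) * nrm E (Z p) \<le> nrm E (R (Z p)) - 2 * e p"
  proof (rule ccontr)
    assume neg: "\<not> ?thesis"
    have le: "nrm E (R (Z p)) - 2 * e p \<le> (\<rho> + B * \<epsilon>) * nrm E (Z p)" if p: "p \<in> P" for p
    proof (cases "nrm E (Z p) = 0")
      case True
      then show ?thesis
        using nrm_le_operator_norm[OF E R Zp[OF p]] e0[OF p] by simp
    next
      case False
      then show ?thesis using neg p nrm_nonneg[OF Zp[OF p]] by force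
    qed
    have "nrm E (R x) - 2 * \<epsilon> \<le> (\<Sum>p\<in>P. nrm E (R (Z p))) - 2 * (\<Sum>p\<in>P. e p)"
      using normed_space_linear_finsum_le[OF E lin P Z] e by (simp add: xZ)
    also have "\<dots> = (\<Sum>p\<in>P. nrm E (R (Z p)) - 2 * e p)"
      by (simp add: sum_subtractf sum_distrib_left)
    also have "\<dots> \<le> (\<Sum>p\<in>P. (\<rho> + B * \<epsilon>) * nrm E (Z p))" by (intro sum_mono le)
    also have "\<dots> = (\<rho> + B * \<epsilon>) * (\<Sum>p\<in>P. nrm E (Z p))" by (simp add: sum_distrib_left)
    also have "\<dots> \<le> (\<rho> + B * \<epsilon>) * (1 + \<epsilon>)"
      using nZ x \<rho> B \<epsilon> by (intro mult_left_mono) auto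
    finally show False using room by simp
  qed
  then obtain p where p: "p \<in> P" "0 < nrm E (Z p)"
    and large: "(\<rho> + B * \<epsilon>) * nrm E (Z p) \<le> nrm E (R (Z p)) - 2 * e p" by blast
  define n where "n = nrm E (Z p)"
  obtain c where c: "R (Z p) = c \<odot>\<^bsub>E\<^esub> y" using y(3) Zp[OF p(1)] by blast
  have "norm c * N \<le> L * n"
    using nrm_le_operator_norm[OF E R Zp[OF p(1)]] nrm_smult[OF y(1), of c] by (simp add: c N_def L_def n_def)
  then have "2 * (norm c * \<epsilon>) \<le> B * \<epsilon> * n"
    using N \<epsilon> by (simp add: B_def field_simps)
  then have big: "n * (1 + \<rho>) \<le> nrm E (Z p \<oplus>\<^bsub>E\<^esub> R (Z p))"
    using sep[OF p(1), of c] large by (simp add: c n_def algebra_simps)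
  let ?t = "of_real (1 / n) :: 'k"
  have t: "norm ?t = 1 / n" using p by (simp add: n_def norm_divide)
  let ?u = "?t \<odot>\<^bsub>E\<^esub> Z p"
  have "?u \<oplus>\<^bsub>E\<^esub> R ?u = ?t \<odot>\<^bsub>E\<^esub> (Z p \<oplus>\<^bsub>E\<^esub> R (Z p))"
  proof -
    have "R ?u = ?t \<odot>\<^bsub>E\<^esub> R (Z p)" using lin Zp[OF p(1)] by (simp add: linear_operator_def)
    then show ?thesis
      using Zp[OF p(1)] R_closed by (simp add: smult_r_distr ring_of_type_algebra_def)
  qed
  then have "nrm E (?u \<oplus>\<^bsub>E\<^esub> R ?u) = 1 / n * nrm E (Z p \<oplus>\<^bsub>E\<^esub> R (Z p))"
    using Zp[OF p(1)] R_closed t by (simp add: nrm_smult del: of_real_divide)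
  moreover have "1 + \<rho> \<le> 1 / n * nrm E (Z p \<oplus>\<^bsub>E\<^esub> R (Z p))"
    using big p by (simp add: n_def field_simps)
  moreover have "nrm E ?u = 1"
    using Zp[OF p(1)] t p by (simp add: nrm_smult n_def del: of_real_divide)
  ultimately show ?thesis
    using Zp[OF p(1)] by (intro bexI[of _ ?u]) (auto simp: smult_closed')
qed

lemma daugavet_property_if_splitting:
  fixes E :: "('k::real_normed_field, 'x) normed_module"
  assumes E: "banach_space E" and split: "daugavet_splitting E"
  shows "daugavet_property E"
  unfolding daugavet_property_def
proof (intro conjI E allI impI, elim conjE)
  fix R assume R: "bounded_operator E R" and rank: "rank_one E R"
  have E': "normed_space E" using E by (simp add: banach_space_def)
  interpret Module.module "ring_of_type_algebra :: 'k ring" E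
    using E' by (simp add: normed_space_def)
  let ?U = "{x \<in> carrier E. nrm E x \<le> 1}"
  let ?L = "operator_norm E R"
  have R_closed: "R v \<in> carrier E" if "v \<in> carrier E" for v
    using R that by (auto simp: linear_operator_def bounded_operator_def)
  have "nrm E \<zero>\<^bsub>E\<^esub> = 0" using E' by (simp add: normed_space_def)
  then have ne: "?U \<noteq> {}" by (auto intro!: exI[of _ "\<zero>\<^bsub>E\<^esub>"])
  have upper: "nrm E (v \<oplus>\<^bsub>E\<^esub> R v) \<le> 1 + ?L" if "v \<in> ?U" for v
  proof -
    have "nrm E (R v) \<le> ?L"
      unfolding operator_norm_def using that by (intro cSUP_upper bdd_above_operator_norm E' R)
    moreover have "nrm E (v \<oplus>\<^bsub>E\<^esub> R v) \<le> nrm E v + nrm E (R v)"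
      using E' that R_closed by (simp add: normed_space_def)
    ultimately show ?thesis using that by simp
  qed
  show "operator_norm E (\<lambda>x. x \<oplus>\<^bsub>E\<^esub> R x) = 1 + ?L"
  proof (rule antisym)
    show "operator_norm E (\<lambda>x. x \<oplus>\<^bsub>E\<^esub> R x) \<le> 1 + ?L"
      unfolding operator_norm_def[of E "\<lambda>x. x \<oplus>\<^bsub>E\<^esub> R x"] using ne upper by (rule cSUP_least)
    have "0 < ?L"
    proof -
      obtain y where y: "y \<in> carrier E" "y \<noteq> \<zero>\<^bsub>E\<^esub>" "R ` carrier E = range (\<lambda>c. c \<odot>\<^bsub>E\<^esub> y)"
        using rank by (auto simp: rank_one_def)
      have "1 \<odot>\<^bsub>E\<^esub> y = y" using smult_one[OF y(1)] by (simp add: ring_of_type_algebra_def)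
      then have "y \<in> R ` carrier E" using y(3) by (metis rangeI)
      then obtain v where v: "v \<in> carrier E" "R v = y" by auto
      have "0 < nrm E y" using E' y by (simp add: normed_space_def order_less_le)
      also have "\<dots> \<le> ?L * nrm E v" using nrm_le_operator_norm[OF E' R v(1)] v by simp
      finally show ?thesis
        using E' v by (auto simp: normed_space_def zero_less_mult_iff)
    qed
    show "1 + ?L \<le> operator_norm E (\<lambda>x. x \<oplus>\<^bsub>E\<^esub> R x)"
    proof (rule dense_le)
      fix r assume "r < 1 + ?L"
      then obtain \<rho> where \<rho>: "max 0 (r - 1) < \<rho>" "\<rho> < ?L"
        using dense[of "max 0 (r - 1)" ?L] \<open>0 < ?L\<close> by auto
      have "\<exists>x\<in>?U. \<rho> < nrm E (R x)"
        using \<rho>(2) less_cSUP_iff[OF ne bdd_above_operator_norm[OF E' R], of \<rho>] by (simp add: operator_norm_def)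
      then obtain x where "x \<in> carrier E" "nrm E x \<le> 1" "\<rho> < nrm E (R x)" by auto
      from daugavet_lower_bound[OF E' split R rank this(1,2) _ this(3)] \<rho>
      obtain u where u: "u \<in> ?U" "1 + \<rho> \<le> nrm E (u \<oplus>\<^bsub>E\<^esub> R u)" by auto
      have "r \<le> nrm E (u \<oplus>\<^bsub>E\<^esub> R u)" using u \<rho> by simp
      also have "\<dots> \<le> operator_norm E (\<lambda>x. x \<oplus>\<^bsub>E\<^esub> R x)"
        unfolding operator_norm_def
        using u(1) by (rule cSUP_upper) (rule bdd_aboveI2[of _ _ "1 + ?L"], rule upper)
      finally show "r \<le> operator_norm E (\<lambda>x. x \<oplus>\<^bsub>E\<^esub> R x)" .
    qed
  qed
qed

section \<open>Completeness and the Daugavet property of the orbit space\<close>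

text \<open>A subsequence with geometrically decreasing increments converges almost everywhere and in mean, as a
  series with summable norms.\<close>

lemma L1_complete:
  fixes f :: "nat \<Rightarrow> 'w \<Rightarrow> 'k::{banach, second_countable_topology}"
  assumes f: "\<And>n. integrable M (f n)"
    and cauchy: "\<And>e. 0 < e \<Longrightarrow> \<exists>N. \<forall>m\<ge>N. \<forall>n\<ge>N. (\<integral>x. norm (f m x - f n x) \<partial>M) < e"
  shows "\<exists>F. integrable M F \<and> (\<lambda>n. \<integral>x. norm (f n x - F x) \<partial>M) \<longlonglongrightarrow> 0"
proof -
  have "\<exists>N. \<forall>m\<ge>N. \<forall>n\<ge>N. (\<integral>x. norm (f m x - f n x) \<partial>M) < (1 / 2) ^ j" for j
    by (rule cauchy) simp
  then obtain N where N: "\<And>j m n. N j \<le> m \<Longrightarrow> N j \<le> n \<Longrightarrow> (\<integral>x. norm (f m x - f n x) \<partial>M) < (1 / 2) ^ j"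
    by metis
  \<comment> \<open>The summand \<open>j\<close> makes the indices tend to infinity.\<close>
  define r where "r j = (\<Sum>i\<le>j. N i) + j" for j
  have r: "N j \<le> r j" "r j \<le> r (Suc j)" "j \<le> r j" for j
  proof -
    have "N j \<le> (\<Sum>i\<le>j. N i)" by (rule member_le_sum) auto
    then show "N j \<le> r j" "r j \<le> r (Suc j)" "j \<le> r j" by (simp_all add: r_def)
  qed
  define d where "d j x = f (r (Suc j)) x - f (r j) x" for j x
  have d_int: "integrable M (d j)" for j unfolding d_def[abs_def] using f by auto
  have d_le: "(\<integral>x. norm (d j x) \<partial>M) \<le> (1 / 2) ^ j" for j
    unfolding d_def using N[of j "r (Suc j)" "r j"] r[of j] by linarith
  have geo: "summable (\<lambda>j. (1 / 2 :: real) ^ j)" by (rule summable_geometric) simp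
  have d_sum: "summable (\<lambda>j. \<integral>x. norm (d j x) \<partial>M)"
    by (rule summable_comparison_test'[OF geo, of 0]) (use d_le in auto)
  have ae: "AE x in M. summable (\<lambda>j. norm (d j x))"
    by (rule AE_summable_if_summable_integral) (use d_int d_sum in auto)
  define F where "F x = f (r 0) x + (\<Sum>j. d j x)" for x
  have F: "integrable M F"
    unfolding F_def[abs_def] using f integrable_suminf[OF d_int ae d_sum] by (intro Bochner_Integration.integrable_add)
  have tail: "(\<integral>x. norm (f (r n) x - F x) \<partial>M) \<le> 2 * (1 / 2) ^ n" for n
  proof -
    have ae_n: "AE x in M. summable (\<lambda>j. norm (norm (d (j + n) x)))"
      using ae by eventually_elim (simp add: summable_iff_shift[of "\<lambda>j. norm (d j _)"])
    have sum_n: "summable (\<lambda>j. \<integral>x. norm (norm (d (j + n) x)) \<partial>M)"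
      using d_sum by (simp add: summable_iff_shift[of "\<lambda>j. \<integral>x. norm (d j x) \<partial>M"])
    have int_n: "integrable M (\<lambda>x. norm (d (j + n) x))" for j using d_int by auto
    have "(\<integral>x. norm (f (r n) x - F x) \<partial>M) \<le> (\<integral>x. (\<Sum>j. norm (d (j + n) x)) \<partial>M)"
    proof (rule integral_mono_AE[OF _ integrable_suminf[OF int_n ae_n sum_n]])
      show "AE x in M. norm (f (r n) x - F x) \<le> (\<Sum>j. norm (d (j + n) x))"
        using ae ae_n
      proof eventually_elim
        case (elim x)
        have "(\<Sum>j<n. d j x) = f (r n) x - f (r 0) x"
          unfolding d_def by (rule sum_lessThan_telescope)
        moreover have "(\<Sum>j. d (j + n) x) = (\<Sum>j. d j x) - (\<Sum>j<n. d j x)"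
          by (rule suminf_minus_initial_segment[OF summable_norm_cancel[OF elim(1)]])
        ultimately have "f (r n) x - F x = - (\<Sum>j. d (j + n) x)" by (simp add: F_def)
        then show ?case using elim summable_norm[of "\<lambda>j. d (j + n) x"] by simp
      qed
    qed (use f F in auto)
    also have "\<dots> = (\<Sum>j. \<integral>x. norm (d (j + n) x) \<partial>M)"
      by (rule integral_suminf[OF int_n ae_n sum_n])
    also have "\<dots> \<le> (\<Sum>j. (1 / 2) ^ n * (1 / 2) ^ j)"
    proof (rule suminf_le)
      show "(\<integral>x. norm (d (j + n) x) \<partial>M) \<le> (1 / 2) ^ n * (1 / 2) ^ j" for j
        using d_le[of "j + n"] by (simp add: power_add mult.commute)
    qed (use sum_n geo in \<open>auto intro: summable_mult\<close>)
    also have "\<dots> = 2 * (1 / 2) ^ n"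
      using geo by (simp add: suminf_mult suminf_geometric)
    finally show ?thesis .
  qed
  have "(\<lambda>n. \<integral>x. norm (f n x - F x) \<partial>M) \<longlonglongrightarrow> 0"
  proof (rule LIMSEQ_I)
    fix e :: real assume "0 < e"
    then obtain K where K: "\<And>m n. K \<le> m \<Longrightarrow> K \<le> n \<Longrightarrow> (\<integral>x. norm (f m x - f n x) \<partial>M) < e / 2"
      using cauchy[of "e / 2"] by auto
    have "(\<lambda>n. 2 * (1 / 2 :: real) ^ n) \<longlonglongrightarrow> 0" by real_asymp
    then have "\<forall>\<^sub>F n in sequentially. 2 * (1 / 2 :: real) ^ n < e / 2"
      by (rule order_tendstoD(2)) (use \<open>0 < e\<close> in simp)
    then have "\<forall>\<^sub>F n in sequentially. 2 * (1 / 2 :: real) ^ n < e / 2 \<and> K \<le> n"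
      using eventually_ge_at_top[of K] by eventually_elim auto
    then obtain n where n: "2 * (1 / 2 :: real) ^ n < e / 2" "K \<le> n"
      by (auto dest: eventually_happens)
    have "norm ((\<integral>x. norm (f m x - F x) \<partial>M) - 0) < e" if "K \<le> m" for m
    proof -
      have "(\<integral>x. norm (f m x - F x) \<partial>M) \<le> (\<integral>x. norm (f m x - f (r n) x) + norm (f (r n) x - F x) \<partial>M)"
      proof (rule integral_mono)
        show "norm (f m x - F x) \<le> norm (f m x - f (r n) x) + norm (f (r n) x - F x)" for x
          using norm_triangle_ineq[of "f m x - f (r n) x" "f (r n) x - F x"] by simp
      qed (use f F in auto)
      also have "\<dots> = (\<integral>x. norm (f m x - f (r n) x) \<partial>M) + (\<integral>x. norm (f (r n) x - F x) \<partial>M)"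
        using f F by (intro Bochner_Integration.integral_add) auto
      also have "\<dots> < e / 2 + e / 2"
        using K[OF that, of "r n"] r(3)[of n] n tail[of n] by linarith
      finally show ?thesis by simp
    qed
    then show "\<exists>no. \<forall>m\<ge>no. norm ((\<integral>x. norm (f m x - F x) \<partial>M) - 0) < e" by blast
  qed
  with F show ?thesis by blast
qed

context orbit_weights
begin

context
  fixes E :: "('k::{real_normed_field, banach, second_countable_topology}, ('w \<Rightarrow> 'k) set) normed_module"
  defines E_def: "E \<equiv> orbit_L1 M T a"
begin

lemma carrier_E: "carrier E = ae_class M ` {f. integrable M f}"
  and zero_E: "\<zero>\<^bsub>E\<^esub> = ae_class M (\<lambda>_. 0)"
  by (simp_all add: E_def orbit_L1_def)

lemma carrier_E_cases:
  assumes "v \<in> carrier E"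
  obtains f where "integrable M f" "v = ae_class M f"
  using assms by (auto simp: carrier_E)

lemma class_in_E: "integrable M f \<Longrightarrow> ae_class M f \<in> carrier E"
  by (simp add: carrier_E)

lemma add_E: "integrable M f \<Longrightarrow> integrable M g \<Longrightarrow>
    ae_class M f \<oplus>\<^bsub>E\<^esub> ae_class M g = ae_class M (\<lambda>x. f x + g x)"
  unfolding E_def by (rule orbit_L1_add)

lemma smult_E: "integrable M f \<Longrightarrow> c \<odot>\<^bsub>E\<^esub> ae_class M f = ae_class M (\<lambda>x. c * f x)"
  unfolding E_def by (rule orbit_L1_smult)

lemma nrm_E:
  assumes "integrable M f"
  shows "nrm E (ae_class M f) = orbit_norm M T a f"
  using orbit_norm_cong_AE[OF ae_rep_class(2)[OF assms]] ae_rep_class(1)[OF assms] assms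
  by (simp add: E_def orbit_L1_def)

lemma abelian_group_E: "abelian_group E"
proof (rule abelian_groupI)
  fix u v assume "u \<in> carrier E" "v \<in> carrier E"
  then obtain f g where fg: "integrable M f" "u = ae_class M f" "integrable M g" "v = ae_class M g"
    by (auto elim!: carrier_E_cases)
  then show "u \<oplus>\<^bsub>E\<^esub> v \<in> carrier E" by (simp add: add_E class_in_E)
  show "u \<oplus>\<^bsub>E\<^esub> v = v \<oplus>\<^bsub>E\<^esub> u" using fg by (simp add: add_E add.commute)
  fix w assume "w \<in> carrier E"
  then obtain h where "integrable M h" "w = ae_class M h" by (auto elim!: carrier_E_cases)
  with fg show "(u \<oplus>\<^bsub>E\<^esub> v) \<oplus>\<^bsub>E\<^esub> w = u \<oplus>\<^bsub>E\<^esub> (v \<oplus>\<^bsub>E\<^esub> w)" by (simp add: add_E add.assoc)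
next
  show "\<zero>\<^bsub>E\<^esub> \<in> carrier E" by (simp add: zero_E class_in_E)
  fix u assume "u \<in> carrier E"
  then obtain f where f: "integrable M f" "u = ae_class M f" by (auto elim!: carrier_E_cases)
  then show "\<zero>\<^bsub>E\<^esub> \<oplus>\<^bsub>E\<^esub> u = u" by (simp add: add_E zero_E)
  show "\<exists>v\<in>carrier E. v \<oplus>\<^bsub>E\<^esub> u = \<zero>\<^bsub>E\<^esub>"
    using f by (intro bexI[of _ "ae_class M (\<lambda>x. - f x)"]) (simp_all add: add_E zero_E class_in_E)
qed

lemma module_E: "Module.module (ring_of_type_algebra :: 'k ring) E"
proof (rule moduleI[OF cring_from_type_algebra abelian_group_E])
  fix c b :: 'k and u assume "u \<in> carrier E"
  then obtain f where f: "integrable M f" "u = ae_class M f" by (auto elim!: carrier_E_cases)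
  show "c \<odot>\<^bsub>E\<^esub> u \<in> carrier E" using f by (simp add: smult_E class_in_E)
  show "(c \<oplus>\<^bsub>ring_of_type_algebra\<^esub> b) \<odot>\<^bsub>E\<^esub> u = (c \<odot>\<^bsub>E\<^esub> u) \<oplus>\<^bsub>E\<^esub> (b \<odot>\<^bsub>E\<^esub> u)"
    using f by (simp add: smult_E add_E ring_of_type_algebra_def distrib_right)
  show "(c \<otimes>\<^bsub>ring_of_type_algebra\<^esub> b) \<odot>\<^bsub>E\<^esub> u = c \<odot>\<^bsub>E\<^esub> (b \<odot>\<^bsub>E\<^esub> u)"
    using f by (simp add: smult_E ring_of_type_algebra_def mult.assoc)
  show "\<one>\<^bsub>ring_of_type_algebra\<^esub> \<odot>\<^bsub>E\<^esub> u = u"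
    using f by (simp add: smult_E ring_of_type_algebra_def)
  fix v assume "v \<in> carrier E"
  then obtain g where "integrable M g" "v = ae_class M g" by (auto elim!: carrier_E_cases)
  then show "c \<odot>\<^bsub>E\<^esub> (u \<oplus>\<^bsub>E\<^esub> v) = (c \<odot>\<^bsub>E\<^esub> u) \<oplus>\<^bsub>E\<^esub> (c \<odot>\<^bsub>E\<^esub> v)"
    using f by (simp add: smult_E add_E distrib_left)
qed

lemma minus_E:
  assumes "integrable M f" "integrable M g"
  shows "ae_class M f \<ominus>\<^bsub>E\<^esub> ae_class M g = ae_class M (\<lambda>x. f x - g x)"
proof -
  interpret abelian_group E by (rule abelian_group_E)
  have "\<ominus>\<^bsub>E\<^esub> ae_class M g = ae_class M (\<lambda>x. - g x)"
    using assms by (intro minus_equality) (simp_all add: add_E zero_E class_in_E)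
  then show ?thesis using assms by (simp add: a_minus_def add_E)
qed

lemma normed_space_E: "normed_space E"
  unfolding normed_space_def
proof (intro conjI module_E ballI allI)
  fix u assume "u \<in> carrier E"
  then obtain f where f: "integrable M f" "u = ae_class M f" by (auto elim!: carrier_E_cases)
  show "0 \<le> nrm E u" using f by (simp add: nrm_E orbit_norm_nonneg)
  show "nrm E (c \<odot>\<^bsub>E\<^esub> u) = norm c * nrm E u" for c
    using f by (simp add: nrm_E smult_E orbit_norm_cmult)
  show "nrm E u = 0 \<longleftrightarrow> u = \<zero>\<^bsub>E\<^esub>"
  proof
    assume "nrm E u = 0"
    then have "sqrt (a 0) * (\<integral>x. norm (f x) \<partial>M) \<le> 0"
      using f orbit_norm_ge[OF f(1)] by (simp add: nrm_E)
    then have "(\<integral>x. norm (f x) \<partial>M) \<le> 0"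
      using a_pos[of 0] by (simp add: mult_le_0_iff)
    then have "(\<integral>x. norm (f x) \<partial>M) = 0" by (intro antisym) auto
    then have "AE x in M. f x = 0"
      using f integral_nonneg_eq_0_iff_AE[of M "\<lambda>x. norm (f x)"] by simp
    then show "u = \<zero>\<^bsub>E\<^esub>" unfolding f zero_E by (rule ae_class_eqI)
  next
    assume "u = \<zero>\<^bsub>E\<^esub>"
    then show "nrm E u = 0"
      using orbit_norm_cmult[of 0 "\<lambda>_. 0 :: 'k"] by (simp add: zero_E nrm_E)
  qed
  fix v assume "v \<in> carrier E"
  then obtain g where "integrable M g" "v = ae_class M g" by (auto elim!: carrier_E_cases)
  then show "nrm E (u \<oplus>\<^bsub>E\<^esub> v) \<le> nrm E u + nrm E v"
    using f by (simp add: nrm_E add_E orbit_norm_triangle)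
qed

lemma banach_space_E: "banach_space E"
  unfolding banach_space_def
proof (intro conjI normed_space_E allI impI, elim conjE)
  fix s :: "nat \<Rightarrow> ('w \<Rightarrow> 'k) set"
  assume s: "range s \<subseteq> carrier E"
    and cauchy: "\<forall>\<epsilon>>0. \<exists>N. \<forall>m\<ge>N. \<forall>n\<ge>N. nrm E (s m \<ominus>\<^bsub>E\<^esub> s n) < \<epsilon>"
  have "\<exists>f. integrable M f \<and> s n = ae_class M f" for n
    using s by (auto simp: carrier_E)
  then obtain f where f: "\<And>n. integrable M (f n)" "\<And>n. s n = ae_class M (f n)" by metis
  have pos: "0 < sqrt (a 0)" using a_pos by simp
  have "\<exists>F. integrable M F \<and> (\<lambda>n. \<integral>x. norm (f n x - F x) \<partial>M) \<longlonglongrightarrow> 0"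
  proof (rule L1_complete[OF f(1)])
    fix e :: real assume "0 < e"
    then have "0 < sqrt (a 0) * e" using pos by simp
    then obtain N where N: "\<And>m n. m \<ge> N \<Longrightarrow> n \<ge> N \<Longrightarrow> nrm E (s m \<ominus>\<^bsub>E\<^esub> s n) < sqrt (a 0) * e"
      using cauchy by blast
    have "(\<integral>x. norm (f m x - f n x) \<partial>M) < e" if "m \<ge> N" "n \<ge> N" for m n
    proof -
      have "sqrt (a 0) * (\<integral>x. norm (f m x - f n x) \<partial>M) < sqrt (a 0) * e"
        using N[OF that] orbit_norm_ge[of "\<lambda>x. f m x - f n x"] f by (simp add: minus_E nrm_E)
      then show ?thesis using pos by simp
    qed
    then show "\<exists>N. \<forall>m\<ge>N. \<forall>n\<ge>N. (\<integral>x. norm (f m x - f n x) \<partial>M) < e" by blast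
  qed
  then obtain F where F: "integrable M F" and lim: "(\<lambda>n. \<integral>x. norm (f n x - F x) \<partial>M) \<longlonglongrightarrow> 0"
    by blast
  have "(\<lambda>n. nrm E (s n \<ominus>\<^bsub>E\<^esub> ae_class M F)) \<longlonglongrightarrow> 0"
  proof (rule tendsto_sandwich[OF _ _ tendsto_const])
    show "\<forall>\<^sub>F n in sequentially. nrm E (s n \<ominus>\<^bsub>E\<^esub> ae_class M F) \<le> root_weight_sum * (\<integral>x. norm (f n x - F x) \<partial>M)"
      using f F orbit_norm_le[of "\<lambda>x. f _ x - F x"] by (simp add: minus_E nrm_E)
    show "(\<lambda>n. root_weight_sum * (\<integral>x. norm (f n x - F x) \<partial>M)) \<longlonglongrightarrow> 0"
      using tendsto_mult_right_zero[OF lim] .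
  qed (use f F in \<open>simp add: minus_E nrm_E orbit_norm_nonneg\<close>)
  then show "\<exists>x\<in>carrier E. (\<lambda>n. nrm E (s n \<ominus>\<^bsub>E\<^esub> x)) \<longlonglongrightarrow> 0"
    using F by (intro bexI[of _ "ae_class M F"] class_in_E)
qed

lemma finsum_E:
  assumes "finite P" "\<And>p. p \<in> P \<Longrightarrow> integrable M (u p)"
  shows "(\<Oplus>\<^bsub>E\<^esub>p\<in>P. ae_class M (u p)) = ae_class M (\<lambda>x. \<Sum>p\<in>P. u p x)"
proof -
  interpret abelian_group E by (rule abelian_group_E)
  show ?thesis
    using assms
  proof (induction P rule: finite_induct)
    case empty
    then show ?case by (simp add: zero_E)
  next
    case (insert p P)
    then have "(\<lambda>p. ae_class M (u p)) \<in> P \<rightarrow> carrier E" by (auto intro: class_in_E)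
    then show ?case using insert by (simp add: class_in_E add_E)
  qed
qed

text \<open>The pieces are the restrictions of a representative to the levels of an almost invariant labelling.\<close>

lemma daugavet_splitting_E:
  assumes "atomless M"
  shows "daugavet_splitting E"
  unfolding daugavet_splitting_def
proof (intro ballI allI impI)
  fix u v and \<epsilon> :: real assume "u \<in> carrier E" "v \<in> carrier E" "0 < \<epsilon>"
  then obtain f h where f: "integrable M f" "u = ae_class M f" and h: "integrable M h" "v = ae_class M h"
    by (auto elim!: carrier_E_cases)
  obtain g :: "'w \<Rightarrow> nat \<times> nat" and P
    where g[measurable]: "g \<in> measurable M (count_space UNIV)" and P: "finite P" "\<And>x. x \<in> space M \<Longrightarrow> g x \<in> P"
      and leak: "(\<Sum>p\<in>P. \<integral>x. indicator (space M - level g p) x * orbit_l2 (piece g f p) x \<partial>M) \<le> \<epsilon>"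
      and sum_le: "(\<Sum>p\<in>P. orbit_norm M T a (piece g f p)) \<le> orbit_norm M T a f + \<epsilon>"
      and small: "\<And>p. (\<integral>x. indicator (level g p) x * orbit_l2 h x \<partial>M) \<le> \<epsilon>"
    using orbit_splitting[OF assms f(1) h(1) \<open>0 < \<epsilon>\<close>] by blast
  define e where "e p = (\<integral>x. indicator (space M - level g p) x * orbit_l2 (piece g f p) x \<partial>M)" for p
  note pf = integrable_piece[OF g f(1)]
  have "(\<Sum>p\<in>P. piece g f p x) = f x" if "x \<in> space M" for x
    using P that by (simp add: piece_def sum.delta)
  then have "ae_class M (\<lambda>x. \<Sum>p\<in>P. piece g f p x) = u"
    unfolding f by (intro ae_class_eqI AE_I2) auto
  then have "u = (\<Oplus>\<^bsub>E\<^esub>p\<in>P. ae_class M (piece g f p))"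
    using P pf by (simp add: finsum_E)
  moreover have "orbit_norm M T a (piece g f p) + orbit_norm M T a (\<lambda>x. c * h x)
      \<le> orbit_norm M T a (\<lambda>x. piece g f p x + c * h x) + 2 * e p + 2 * (norm c * \<epsilon>)" for p c
  proof -
    have lev: "level g p \<in> sets M" by measurable
    have "(\<integral>x. indicator (level g p) x * orbit_l2 (\<lambda>x. c * h x) x \<partial>M)
        = norm c * (\<integral>x. indicator (level g p) x * orbit_l2 h x \<partial>M)"
      unfolding orbit_l2_cmult by (simp add: mult.left_commute)
    also have "\<dots> \<le> norm c * \<epsilon>" by (intro mult_left_mono small) simp
    finally show ?thesis
      using orbit_norm_separation[OF pf[of p] _ lev, of "\<lambda>x. c * h x"] h by (simp add: e_def)
  qed
  moreover have "0 \<le> e p" for p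
    by (simp add: e_def orbit_l2_nonneg)
  moreover have "nrm E u = orbit_norm M T a f"
    using f by (simp add: nrm_E)
  ultimately show "\<exists>P :: (nat \<times> nat) set. \<exists>Z e.
        finite P \<and> Z \<in> P \<rightarrow> carrier E \<and> u = (\<Oplus>\<^bsub>E\<^esub>p\<in>P. Z p) \<and>
        (\<Sum>p\<in>P. e p) \<le> \<epsilon> \<and> (\<Sum>p\<in>P. nrm E (Z p)) \<le> nrm E u + \<epsilon> \<and>
        (\<forall>p\<in>P. 0 \<le> e p \<and> (\<forall>c. nrm E (Z p) + nrm E (c \<odot>\<^bsub>E\<^esub> v)
           \<le> nrm E (Z p \<oplus>\<^bsub>E\<^esub> c \<odot>\<^bsub>E\<^esub> v) + 2 * e p + 2 * (norm c * \<epsilon>)))"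
    using P(1) pf leak sum_le h
    by (intro exI[of _ P] exI[of _ "\<lambda>p. ae_class M (piece g f p)"] exI[of _ e])
       (auto simp: class_in_E nrm_E add_E smult_E e_def)
qed

end

lemma daugavet_orbit_L1:
  assumes "atomless M"
  shows "daugavet_property (orbit_L1 M T a
    :: ('k::{real_normed_field, banach, second_countable_topology}, ('w \<Rightarrow> 'k) set) normed_module)"
  by (intro daugavet_property_if_splitting banach_space_E daugavet_splitting_E assms)

end

theorem theorem3p6:
  fixes M :: "'w measure" and T :: "'w \<Rightarrow> 'w" and a :: "int \<Rightarrow> real"
  assumes "prob_space M"
    and "atomless M"
    and "invertible_measure_preserving M T"
    and "\<And>k. 0 < a k"
    and "(a has_sum 1) UNIV"
    and "(\<lambda>k. sqrt (a k)) summable_on UNIV"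
  shows "daugavet_property (orbit_L1 M T a :: (real, ('w \<Rightarrow> real) set) normed_module) \<and>
         daugavet_property (orbit_L1 M T a :: (complex, ('w \<Rightarrow> complex) set) normed_module)"
proof -
  interpret orbit_weights M T a
    using assms by (simp add: orbit_weights_def orbit_weights_axioms_def
        measure_automorphism_def measure_automorphism_axioms_def)
  show ?thesis by (intro conjI daugavet_orbit_L1 assms)
qed

end
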